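(* Let $M$ and $N$ be manifolds, let $p:M\to N$ be a surjective submersion with connected fibers, and let $\mathcal{F}$ be a singular foliation of $N$. Then the map $$\varphi:N/\mathcal{F}\to M/p^{-1}\mathcal{F},\qquad L\mapsto p^{-1}(L)$$ is a diffeological diffeomorphism. Consequently, if $(N_0,\mathcal{F}_0)$ and $(N_1,\mathcal{F}_1)$ are singular foliations, and $p_i:M\to N_i$ ($i=0,1$) are surjective submersions with connected fibers witnessing a Molino transverse equivalence between $\mathcal{F}_0$ and $\mathcal{F}_1$, then the map $$N_0/\mathcal{F}_0\to N_1/\mathcal{F}_1,\qquad L\mapsto p_1(p_0^{-1}(L))$$ is a diffeological diffeomorphism.
   Context: A manifold is a set with a maximal smooth atlas whose topology is Hausdorff and second-countable. Singular foliation: A subset $L\subseteq M$ is a diffeological submanifold if its subspace diffeology (a map $q:O\to L$ from an open subset $O$ of a Cartesian space is a plot iff $q$ is smooth as a map into $M$) is a manifold diffeology, i.e. there is a (necessarily unique) manifold structure on $L$ whose smooth maps $O\to L$ are exactly these plots; $L$ always carries this manifold structure. It is weakly-embedded if moreover the inclusion $L\hookrightarrow M$ is an immersion. A (Stefan) singular foliation of an $n$-dimensional manifold $M$ is a partition $\mathcal{F}$ of $M$ into connected, weakly-embedded submanifolds, called leaves, such that about each $x\in M$ there is a chart $\psi$ of $M$ with: (a) $\psi$ is a diffeomorphism $V\to U\times W$, where $V$ is an open neighbourhood of $x$, $U$ and $W$ are open neighbourhoods of the origin in $\mathbb{R}^k$ and $\mathbb{R}^{n-k}$, and $k$ is the dimension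 of the leaf through $x$; (b) $\psi(x)=(0,0)$; (c) for every leaf $L$ of $\mathcal{F}$, $\psi(L\cap V)=U\times\ell$ for some $\ell\subseteq W$. Pullback: for a surjective submersion with connected fibers $p:M\to N$ and a singular foliation $\mathcal{F}$ of $N$, the pullback $p^{-1}\mathcal{F}$ is the singular foliation of $M$ whose leaves are the sets $p^{-1}(L)$, $L$ a leaf of $\mathcal{F}$ (its tangent distribution is $(dp)^{-1}(T\mathcal{F})$, where $T\mathcal{F}=\bigcup_{y}T_yL_y$ with $L_y$ the leaf through $y$). Molino transverse equivalence: $(N_0,\mathcal{F}_0)$ and $(N_1,\mathcal{F}_1)$ are Molino transverse equivalent if there exist a singular foliation $(M,\mathcal{F})$ and surjective submersions with connected fibers $p_i:M\to N_i$ such that $p_i^{-1}\mathcal{F}_i=\mathcal{F}$ for $i=0,1$; the $p_i$ are then said to witness the equivalence. Leaf space: $M/\mathcal{F}$ is the set of leaves, with the quotient diffeology: a map $q:O\to M/\mathcal{F}$ ($O$ open in a Cartesian space) is a plot iff each $r\in O$ has an open neighbourhood $O'$ and a smooth map $\tilde q:O'\to M$ with $q|_{O'}=\pi\circ\tilde q$, where $\pi:M\to M/\mathcal{F}$ is the quotient map. A diffeological diffeomorphism is a bijection such that it and its inverse carry plots to plots under composition. *)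

theory Defs
  imports "HOL-Analysis.Analysis" "HOL-Library.Disjoint_Sets"
begin

text \<open>
  All dimensions vary inside the statement, so the Cartesian space of dimension \<open>n\<close> is the
  library's \<open>Euclidean_space n\<close>: the real sequences vanishing from index \<open>n\<close> on.
\<close>

section \<open>Smooth maps between open subsets of Cartesian spaces\<close>

definition partial_deriv :: "nat \<Rightarrow> ((nat \<Rightarrow> real) \<Rightarrow> real) \<Rightarrow> (nat \<Rightarrow> real) \<Rightarrow> real" where
  "partial_deriv i g x = deriv (\<lambda>t. g (x(i := t))) (x i)"

text \<open>Being \<open>C\<^sup>k\<close> only makes sense on open subsets \<open>D\<close> of \<open>Euclidean_space m\<close>; it does not depend
  on the values of \<open>g\<close> off \<open>D\<close>.\<close>

fun C_k :: "nat \<Rightarrow> nat \<Rightarrow> (nat \<Rightarrow> real) set \<Rightarrow> ((nat \<Rightarrow> real) \<Rightarrow> real) \<Rightarrow> bool" where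
  "C_k 0 m D g \<longleftrightarrow> continuous_map (subtopology (Euclidean_space m) D) euclideanreal g"
| "C_k (Suc k) m D g \<longleftrightarrow>
     continuous_map (subtopology (Euclidean_space m) D) euclideanreal g \<and>
     (\<forall>i<m. (\<forall>x\<in>D. (\<lambda>t. g (x(i := t))) differentiable (at (x i))) \<and>
            C_k k m D (partial_deriv i g))"

definition smooth_euclidean ::
    "nat \<Rightarrow> nat \<Rightarrow> (nat \<Rightarrow> real) set \<Rightarrow> ((nat \<Rightarrow> real) \<Rightarrow> nat \<Rightarrow> real) \<Rightarrow> bool" where
  "smooth_euclidean m n D f \<longleftrightarrow>
     openin (Euclidean_space m) D \<and>
     f \<in> D \<rightarrow> topspace (Euclidean_space n) \<and>
     (\<forall>i<n. \<forall>k. C_k k m D (\<lambda>x. f x i))"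

text \<open>The linear map given by the Jacobian matrix of \<open>f\<close> at \<open>a\<close>.\<close>

definition jacobian_map ::
    "nat \<Rightarrow> nat \<Rightarrow> ((nat \<Rightarrow> real) \<Rightarrow> nat \<Rightarrow> real) \<Rightarrow> (nat \<Rightarrow> real) \<Rightarrow> (nat \<Rightarrow> real) \<Rightarrow> (nat \<Rightarrow> real)" where
  "jacobian_map m n f a v =
     (\<lambda>i. if i < n then (\<Sum>j<m. partial_deriv j (\<lambda>x. f x i) a * v j) else 0)"

section \<open>Manifolds\<close>

type_synonym 'a chart = "'a set \<times> ('a \<Rightarrow> nat \<Rightarrow> real)"

record 'a smooth_structure =
  points :: "'a set"
  mdim :: nat
  charts :: "'a chart set"

text \<open>A chart is extensional (\<open>undefined\<close> off its domain), so that a maximal atlas, and hence a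
  smooth structure, is determined by its charts as partial maps.\<close>

definition is_chart :: "'a set \<Rightarrow> nat \<Rightarrow> 'a chart \<Rightarrow> bool" where
  "is_chart X n = (\<lambda>(V, \<psi>). V \<subseteq> X \<and> \<psi> \<in> extensional V \<and> inj_on \<psi> V \<and>
                             openin (Euclidean_space n) (\<psi> ` V))"

definition smooth_transition :: "nat \<Rightarrow> 'a chart \<Rightarrow> 'a chart \<Rightarrow> bool" where
  "smooth_transition n = (\<lambda>(V, \<psi>) (V', \<psi>').
     smooth_euclidean n n (\<psi> ` (V \<inter> V')) (\<psi>' \<circ> inv_into V \<psi>))"

definition compatible_charts :: "nat \<Rightarrow> 'a chart \<Rightarrow> 'a chart \<Rightarrow> bool" where
  "compatible_charts n c c' \<longleftrightarrow> smooth_transition n c c' \<and> smooth_transition n c' c"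

definition smooth_atlas :: "'a set \<Rightarrow> nat \<Rightarrow> 'a chart set \<Rightarrow> bool" where
  "smooth_atlas X n A \<longleftrightarrow>
     (\<forall>c\<in>A. is_chart X n c) \<and> (\<Union>(V, \<psi>)\<in>A. V) = X \<and>
     (\<forall>c\<in>A. \<forall>c'\<in>A. compatible_charts n c c')"

definition maximal_atlas :: "'a set \<Rightarrow> nat \<Rightarrow> 'a chart set \<Rightarrow> bool" where
  "maximal_atlas X n A \<longleftrightarrow>
     smooth_atlas X n A \<and>
     (\<forall>c. is_chart X n c \<and> (\<forall>c'\<in>A. compatible_charts n c c') \<longrightarrow> c \<in> A)"

text \<open>For a maximal atlas the chart domains form a basis of the topology that makes all charts
  homeomorphisms onto open sets.\<close>

definition manifold_topology :: "'a smooth_structure \<Rightarrow> 'a topology" where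
  "manifold_topology M = topology_generated_by (fst ` charts M)"

definition manifold :: "'a smooth_structure \<Rightarrow> bool" where
  "manifold M \<longleftrightarrow>
     maximal_atlas (points M) (mdim M) (charts M) \<and>
     Hausdorff_space (manifold_topology M) \<and>
     second_countable (manifold_topology M)"

section \<open>Smooth maps, immersions, submersions\<close>

definition smooth_from ::
    "nat \<Rightarrow> (nat \<Rightarrow> real) set \<Rightarrow> 'a smooth_structure \<Rightarrow> ((nat \<Rightarrow> real) \<Rightarrow> 'a) \<Rightarrow> bool" where
  "smooth_from m D M q \<longleftrightarrow>
     openin (Euclidean_space m) D \<and> q \<in> D \<rightarrow> points M \<and>
     (\<forall>r\<in>D. \<exists>D' W \<eta>. r \<in> D' \<and> D' \<subseteq> D \<and> (W, \<eta>) \<in> charts M \<and> q ` D' \<subseteq> W \<and>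
        smooth_euclidean m (mdim M) D' (\<eta> \<circ> q))"

definition smooth_map ::
    "'a smooth_structure \<Rightarrow> 'b smooth_structure \<Rightarrow> ('a \<Rightarrow> 'b) \<Rightarrow> bool" where
  "smooth_map M N f \<longleftrightarrow>
     f \<in> points M \<rightarrow> points N \<and>
     (\<forall>(V, \<phi>)\<in>charts M. smooth_from (mdim M) (\<phi> ` V) N (f \<circ> inv_into V \<phi>))"

text \<open>The differential of \<open>f\<close> at \<open>x\<close> in the coordinates of a chart at \<open>x\<close> and a chart at \<open>f x\<close>.\<close>

definition differential_in ::
    "'a smooth_structure \<Rightarrow> 'b smooth_structure \<Rightarrow> ('a \<Rightarrow> 'b) \<Rightarrow> 'a \<Rightarrow> 'a chart \<Rightarrow> 'b chart \<Rightarrow>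
     (nat \<Rightarrow> real) \<Rightarrow> (nat \<Rightarrow> real)" where
  "differential_in M N f x = (\<lambda>(V, \<phi>) (W, \<eta>).
     jacobian_map (mdim M) (mdim N) (\<eta> \<circ> f \<circ> inv_into V \<phi>) (\<phi> x))"

definition immersion ::
    "'a smooth_structure \<Rightarrow> 'b smooth_structure \<Rightarrow> ('a \<Rightarrow> 'b) \<Rightarrow> bool" where
  "immersion M N f \<longleftrightarrow>
     smooth_map M N f \<and>
     (\<forall>x\<in>points M. \<forall>c\<in>charts M. \<forall>d\<in>charts N. x \<in> fst c \<and> f x \<in> fst d \<longrightarrow>
        inj_on (differential_in M N f x c d) (topspace (Euclidean_space (mdim M))))"

definition submersion ::
    "'a smooth_structure \<Rightarrow> 'b smooth_structure \<Rightarrow> ('a \<Rightarrow> 'b) \<Rightarrow> bool" where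
  "submersion M N f \<longleftrightarrow>
     smooth_map M N f \<and>
     (\<forall>x\<in>points M. \<forall>c\<in>charts M. \<forall>d\<in>charts N. x \<in> fst c \<and> f x \<in> fst d \<longrightarrow>
        differential_in M N f x c d ` topspace (Euclidean_space (mdim M))
          = topspace (Euclidean_space (mdim N)))"

definition surj_submersion_connected_fibers ::
    "'a smooth_structure \<Rightarrow> 'b smooth_structure \<Rightarrow> ('a \<Rightarrow> 'b) \<Rightarrow> bool" where
  "surj_submersion_connected_fibers M N p \<longleftrightarrow>
     submersion M N p \<and> p ` points M = points N \<and>
     (\<forall>y\<in>points N. connectedin (manifold_topology M) {x \<in> points M. p x = y})"

section \<open>Diffeology\<close>

text \<open>A diffeology is given by its plots \<open>q : D \<rightarrow> X\<close>, with \<open>D\<close> open in \<open>Euclidean_space m\<close>;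
  the predicate takes \<open>m\<close>, \<open>D\<close> and \<open>q\<close>, and only the values of \<open>q\<close> on \<open>D\<close> matter.\<close>

type_synonym 'a diffeology = "nat \<Rightarrow> (nat \<Rightarrow> real) set \<Rightarrow> ((nat \<Rightarrow> real) \<Rightarrow> 'a) \<Rightarrow> bool"

definition manifold_diffeology :: "'a smooth_structure \<Rightarrow> 'a diffeology" where
  "manifold_diffeology M = (\<lambda>m D q. smooth_from m D M q)"

definition subspace_diffeology :: "'a diffeology \<Rightarrow> 'a set \<Rightarrow> 'a diffeology" where
  "subspace_diffeology \<D> L = (\<lambda>m D q. q \<in> D \<rightarrow> L \<and> \<D> m D q)"

definition diffeological_diffeomorphism ::
    "'a set \<Rightarrow> 'a diffeology \<Rightarrow> 'b set \<Rightarrow> 'b diffeology \<Rightarrow> ('a \<Rightarrow> 'b) \<Rightarrow> bool" where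
  "diffeological_diffeomorphism X \<D> Y \<E> f \<longleftrightarrow>
     bij_betw f X Y \<and>
     (\<forall>m D q. \<D> m D q \<longrightarrow> \<E> m D (f \<circ> q)) \<and>
     (\<forall>m D q. \<E> m D q \<longrightarrow> \<D> m D (inv_into X f \<circ> q))"

section \<open>Singular foliations\<close>

text \<open>\<open>S\<close> is the (unique) manifold structure that the diffeological submanifold \<open>L\<close> carries.\<close>

definition submanifold_structure ::
    "'a smooth_structure \<Rightarrow> 'a set \<Rightarrow> 'a smooth_structure \<Rightarrow> bool" where
  "submanifold_structure M L S \<longleftrightarrow>
     L \<subseteq> points M \<and> manifold S \<and> points S = L \<and>
     manifold_diffeology S = subspace_diffeology (manifold_diffeology M) L"

definition weakly_embedded_structure ::
    "'a smooth_structure \<Rightarrow> 'a set \<Rightarrow> 'a smooth_structure \<Rightarrow> bool" where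
  "weakly_embedded_structure M L S \<longleftrightarrow> submanifold_structure M L S \<and> immersion S M (\<lambda>x. x)"

text \<open>\<open>U \<times> W\<close>, for \<open>U\<close> in \<open>Euclidean_space k\<close> and \<open>W\<close> in \<open>Euclidean_space (n - k)\<close>, as a subset of
  \<open>Euclidean_space n\<close>.\<close>

definition euclidean_pair :: "nat \<Rightarrow> (nat \<Rightarrow> real) \<Rightarrow> (nat \<Rightarrow> real) \<Rightarrow> (nat \<Rightarrow> real)" where
  "euclidean_pair k u w = (\<lambda>i. if i < k then u i else w (i - k))"

definition euclidean_prod ::
    "nat \<Rightarrow> (nat \<Rightarrow> real) set \<Rightarrow> (nat \<Rightarrow> real) set \<Rightarrow> (nat \<Rightarrow> real) set" where
  "euclidean_prod k U W = {euclidean_pair k u w | u w. u \<in> U \<and> w \<in> W}"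

definition foliation_chart ::
    "'a smooth_structure \<Rightarrow> 'a set set \<Rightarrow> 'a \<Rightarrow> nat \<Rightarrow> 'a chart \<Rightarrow> bool" where
  "foliation_chart M \<F> x k = (\<lambda>(V, \<psi>).
     (V, \<psi>) \<in> charts M \<and> x \<in> V \<and> \<psi> x = (\<lambda>_. 0) \<and>
     (\<exists>U W. openin (Euclidean_space k) U \<and> (\<lambda>_. 0) \<in> U \<and>
        openin (Euclidean_space (mdim M - k)) W \<and> (\<lambda>_. 0) \<in> W \<and>
        \<psi> ` V = euclidean_prod k U W \<and>
        (\<forall>L\<in>\<F>. \<exists>l\<subseteq>W. \<psi> ` (L \<inter> V) = euclidean_prod k U l)))"

text \<open>Leaves are connected in their own manifold topology, which may be finer than the subspace
  topology.  Leaves through different points may have different dimensions.\<close>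

definition singular_foliation :: "'a smooth_structure \<Rightarrow> 'a set set \<Rightarrow> bool" where
  "singular_foliation M \<F> \<longleftrightarrow>
     manifold M \<and> partition_on (points M) \<F> \<and>
     (\<forall>L\<in>\<F>. \<exists>S. weakly_embedded_structure M L S \<and>
        connected_space (manifold_topology S) \<and>
        (\<forall>x\<in>L. \<exists>c. foliation_chart M \<F> x (mdim S) c))"

definition leaf_preimage :: "'a smooth_structure \<Rightarrow> ('a \<Rightarrow> 'b) \<Rightarrow> 'b set \<Rightarrow> 'a set" where
  "leaf_preimage M p L = {x \<in> points M. p x \<in> L}"

definition pullback_foliation ::
    "'a smooth_structure \<Rightarrow> ('a \<Rightarrow> 'b) \<Rightarrow> 'b set set \<Rightarrow> 'a set set" where
  "pullback_foliation M p \<F> = leaf_preimage M p ` \<F>"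

definition molino_witnesses ::
    "'a smooth_structure \<Rightarrow> 'a set set \<Rightarrow>
     'b smooth_structure \<Rightarrow> 'b set set \<Rightarrow> ('a \<Rightarrow> 'b) \<Rightarrow>
     'c smooth_structure \<Rightarrow> 'c set set \<Rightarrow> ('a \<Rightarrow> 'c) \<Rightarrow> bool" where
  "molino_witnesses M \<F> N\<^sub>0 \<F>\<^sub>0 p\<^sub>0 N\<^sub>1 \<F>\<^sub>1 p\<^sub>1 \<longleftrightarrow>
     singular_foliation M \<F> \<and>
     surj_submersion_connected_fibers M N\<^sub>0 p\<^sub>0 \<and> pullback_foliation M p\<^sub>0 \<F>\<^sub>0 = \<F> \<and>
     surj_submersion_connected_fibers M N\<^sub>1 p\<^sub>1 \<and> pullback_foliation M p\<^sub>1 \<F>\<^sub>1 = \<F>"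

section \<open>Leaf spaces\<close>

text \<open>The points of the leaf space of \<open>(M, \<F>)\<close> are the leaves, so its underlying set is \<open>\<F>\<close>.\<close>

definition leaf_through :: "'a set set \<Rightarrow> 'a \<Rightarrow> 'a set" where
  "leaf_through \<F> x = (THE L. L \<in> \<F> \<and> x \<in> L)"

definition leaf_space_diffeology :: "'a smooth_structure \<Rightarrow> 'a set set \<Rightarrow> 'a set diffeology" where
  "leaf_space_diffeology M \<F> = (\<lambda>m D q.
     openin (Euclidean_space m) D \<and> q \<in> D \<rightarrow> \<F> \<and>
     (\<forall>r\<in>D. \<exists>D' q'. r \<in> D' \<and> D' \<subseteq> D \<and> openin (Euclidean_space m) D' \<and>
        smooth_from m D' M q' \<and> (\<forall>s\<in>D'. q s = leaf_through \<F> (q' s))))"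

definition leaf_space_diffeomorphism ::
    "'a smooth_structure \<Rightarrow> 'a set set \<Rightarrow> 'b smooth_structure \<Rightarrow> 'b set set \<Rightarrow>
     ('a set \<Rightarrow> 'b set) \<Rightarrow> bool" where
  "leaf_space_diffeomorphism M \<F> N \<G> f \<longleftrightarrow>
     diffeological_diffeomorphism
       \<F> (leaf_space_diffeology M \<F>) \<G> (leaf_space_diffeology N \<G>) f"

end

theory Submission
  imports Defs
begin

text \<open>
  Plots of both leaf spaces lift locally to the manifolds. Composing a lift into \<open>M\<close> with \<open>p\<close> gives a
  lift into \<open>N\<close>; conversely, \<open>p\<close> has smooth local sections, and composing a lift into \<open>N\<close> with a
  section gives a lift into \<open>M\<close>. Since \<open>p\<close> is onto, \<open>L \<mapsto> p\<^sup>-\<^sup>1(L)\<close> is a bijection, so both it and its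
  inverse are smooth.
  For a Molino equivalence, \<open>L \<mapsto> p\<^sub>1(p\<^sub>0\<^sup>-\<^sup>1(L))\<close> is the bijection for \<open>p\<^sub>0\<close> followed by the inverse of
  the one for \<open>p\<^sub>1\<close>.

  The inverse function theorem of the library concerns a Euclidean space that is a type, which
  cannot depend on the dimension of a given manifold. Local sections are therefore built by
  Dini's method, which solves for one coordinate at a time by monotonicity.
\<close>

section \<open>Functions of class \<open>C\<^sup>k\<close>\<close>

text \<open>Smoothness here means that all iterated partial derivatives exist and are continuous, so
  no total derivative is at hand. Its substitute is \<open>partial_mean_value\<close>: a change in
  one coordinate changes a function by that change times a factor tending to the partial derivative,
  even while the base point moves. It yields both the chain rule and the derivative of an implicit
  function. Higher regularity is then bootstrapped: the first derivative of a composite or of an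
  implicit function is a formula in functions already known to be C^k. The induction carries along
  surjectivity of the Jacobian rather than a chosen nonzero minor; a vector mapped to a unit vector
  points to the next coordinate to solve for. Local sections are enough because plots of a leaf
  space are required to lift only locally, and surjectivity provides a point over each value at
  which to start.\<close>

abbreviation euclid :: "nat \<Rightarrow> (nat \<Rightarrow> real) set" where
  "euclid n \<equiv> topspace (Euclidean_space n)"

text \<open>Cubes rather than balls: all estimates below move one coordinate at a time, and a cube
  is described by independent conditions on the coordinates.\<close>

definition ebox :: "nat \<Rightarrow> (nat \<Rightarrow> real) \<Rightarrow> real \<Rightarrow> (nat \<Rightarrow> real) set" where
  "ebox n x e = {y \<in> euclid n. \<forall>i<n. \<bar>y i - x i\<bar> < e}"

lemma euclid_iff: "x \<in> euclid n \<longleftrightarrow> (\<forall>i\<ge>n. x i = 0)"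
  by (simp add: topspace_Euclidean_space)

lemma euclid_eqI:
  assumes "x \<in> euclid n" "y \<in> euclid n" "\<And>i. i < n \<Longrightarrow> x i = y i"
  shows "x = y"
proof
  show "x i = y i" for i using assms by (cases "i < n") (auto simp: euclid_iff)
qed

lemma euclid_upd [simp]: "x \<in> euclid n \<Longrightarrow> i < n \<Longrightarrow> x(i := t) \<in> euclid n"
  by (auto simp: euclid_iff)

lemma Euclidean_space_eq: "Euclidean_space n = top_of_set {x. \<forall>i\<ge>n. x i = 0}"
  by (simp add: Euclidean_space_def euclidean_product_topology)

lemma openin_Euclidean_space_iff:
  "openin (Euclidean_space n) D \<longleftrightarrow> (\<exists>T. open T \<and> D = euclid n \<inter> T)"
  by (simp add: Euclidean_space_eq openin_open)

lemma openin_Euclidean_subset: "openin (Euclidean_space n) D \<Longrightarrow> x \<in> D \<Longrightarrow> x \<in> euclid n"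
  using openin_subset by blast

lemma center_in_ebox: "x \<in> euclid n \<Longrightarrow> e > 0 \<Longrightarrow> x \<in> ebox n x e"
  by (simp add: ebox_def)

lemma ebox_upd:
  "x \<in> euclid n \<Longrightarrow> i < n \<Longrightarrow> \<bar>t - x i\<bar> < e \<Longrightarrow> x(i := t) \<in> ebox n x e"
  by (auto simp: ebox_def)

lemma openin_ebox: "openin (Euclidean_space n) (ebox n x e)"
proof -
  have "open (\<Inter>i\<in>{..<n}. {y. \<bar>y i - x i\<bar> < e})"
    by (intro open_INT finite_lessThan ballI open_Collect_less continuous_intros
        continuous_on_product_coordinates)
  then have "openin (Euclidean_space n) (euclid n \<inter> (\<Inter>i\<in>{..<n}. {y. \<bar>y i - x i\<bar> < e}))"
    unfolding openin_Euclidean_space_iff by blast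
  also have "euclid n \<inter> (\<Inter>i\<in>{..<n}. {y. \<bar>y i - x i\<bar> < e}) = ebox n x e"
    by (auto simp: ebox_def)
  finally show ?thesis .
qed

text \<open>Inside \<open>Euclidean_space n\<close> only the first \<open>n\<close> entries vary, so
  of the infinitely many factors of a basic open set only finitely many impose a condition and one
  radius serves them all.\<close>

lemma openin_contains_ebox:
  assumes "openin (Euclidean_space n) D" "x \<in> D"
  obtains e where "e > 0" "ebox n x e \<subseteq> D"
proof -
  obtain T where T: "open T" "D = euclid n \<inter> T"
    using assms(1) unfolding openin_Euclidean_space_iff by blast
  have "openin (product_topology (\<lambda>i. euclidean) UNIV) T"
    using T(1) by (simp add: euclidean_product_topology)
  then obtain U where U: "\<And>i. open (U i)" "x \<in> Pi\<^sub>E UNIV U" "Pi\<^sub>E UNIV U \<subseteq> T"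
    using assms(2) T(2) unfolding openin_product_topology_alt by auto (metis)
  have xi: "x i \<in> U i" for i using U(2) by auto
  have "\<exists>e>0. \<forall>y. \<bar>y - x i\<bar> < e \<longrightarrow> y \<in> U i" for i
    using U(1)[of i] xi[of i] unfolding open_dist dist_real_def by blast
  then obtain e where e: "\<And>i. e i > 0" "\<And>i y. \<bar>y - x i\<bar> < e i \<Longrightarrow> y \<in> U i" by metis
  \<comment> \<open>The extra 1 keeps the minimum meaningful for \<open>n = 0\<close>.\<close>
  define d where "d = Min (insert 1 (e ` {..<n}))"
  have d: "d > 0" "\<And>i. i < n \<Longrightarrow> d \<le> e i"
    using e(1) by (auto simp: d_def)
  have "ebox n x d \<subseteq> D"
  proof
    fix y assume y: "y \<in> ebox n x d"
    have "y i \<in> U i" for i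
    proof (cases "i < n")
      case True
      then show ?thesis using y d(2)[OF True] by (intro e(2)) (auto simp: ebox_def intro: less_le_trans)
    next
      case False
      have "x i = y i" using y assms(2) T(2) False by (auto simp: ebox_def euclid_iff)
      then show ?thesis using xi[of i] by simp
    qed
    then show "y \<in> D" using U(3) y T(2) by (auto simp: ebox_def PiE_iff)
  qed
  with d(1) show ?thesis using that by blast
qed

lemma continuous_map_Euclidean_subtopology:
  assumes "openin (Euclidean_space m) D"
  shows "continuous_map (subtopology (Euclidean_space m) D) euclideanreal g \<longleftrightarrow> continuous_on D g"
proof -
  have "subtopology (Euclidean_space m) D = top_of_set D"
    using openin_subset[OF assms]
    by (simp add: Euclidean_space_eq subtopology_subtopology Int_absorb1)
  then show ?thesis by simp
qed

lemma continuous_on_ebox: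
  fixes g :: "(nat \<Rightarrow> real) \<Rightarrow> real"
  assumes D: "openin (Euclidean_space m) D" and g: "continuous_on D g" and "x \<in> D" "\<epsilon> > 0"
  obtains d where "d > 0" "ebox m x d \<subseteq> D" "\<And>y. y \<in> ebox m x d \<Longrightarrow> \<bar>g y - g x\<bar> < \<epsilon>"
proof -
  have "openin (subtopology (Euclidean_space m) D)
      {y \<in> topspace (subtopology (Euclidean_space m) D). g y \<in> ball (g x) \<epsilon>}"
    by (rule openin_continuous_map_preimage[where Y = euclideanreal])
      (use g D in \<open>auto simp: continuous_map_Euclidean_subtopology\<close>)
  then have "openin (Euclidean_space m) {y \<in> D. g y \<in> ball (g x) \<epsilon>}"
    using openin_trans_full[OF _ D] topspace_subtopology_subset[OF openin_subset[OF D]] by metis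
  then show ?thesis
    using openin_contains_ebox[of m _ x] assms(3,4) that
    by (smt (verit) dist_real_def mem_Collect_eq mem_ball subset_iff)
qed

lemma continuous_on_eboxI:
  fixes g :: "(nat \<Rightarrow> real) \<Rightarrow> real"
  assumes D: "openin (Euclidean_space m) D"
    and *: "\<And>x \<epsilon>. x \<in> D \<Longrightarrow> \<epsilon> > 0 \<Longrightarrow> \<exists>d>0. \<forall>y\<in>ebox m x d. y \<in> D \<longrightarrow> \<bar>g y - g x\<bar> < \<epsilon>"
  shows "continuous_on D g"
  unfolding continuous_on_topological
proof (intro ballI allI impI)
  fix x B assume x: "x \<in> D" and B: "open B" "g x \<in> B"
  obtain \<epsilon> where e: "\<epsilon> > 0" "\<And>z. \<bar>z - g x\<bar> < \<epsilon> \<Longrightarrow> z \<in> B"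
    using B unfolding open_dist dist_real_def by blast
  obtain d where d: "d > 0" "\<And>y. y \<in> ebox m x d \<Longrightarrow> y \<in> D \<Longrightarrow> \<bar>g y - g x\<bar> < \<epsilon>"
    using *[OF x e(1)] by blast
  obtain T where T: "open T" "ebox m x d = euclid m \<inter> T"
    using openin_ebox[of m x d] unfolding openin_Euclidean_space_iff by blast
  have "x \<in> T" using T(2) center_in_ebox[OF _ d(1)] x D by (metis IntD2 openin_Euclidean_subset)
  moreover have "g y \<in> B" if "y \<in> D" "y \<in> T" for y
    using e(2) d(2) that T(2) openin_Euclidean_subset[OF D] by blast
  ultimately show "\<exists>A. open A \<and> x \<in> A \<and> (\<forall>y\<in>D. y \<in> A \<longrightarrow> g y \<in> B)"
    using T(1) by blast
qed

lemma eventually_ebox: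
  assumes "\<And>i. i < m \<Longrightarrow> ((\<lambda>s. u s i) \<longlongrightarrow> y i) F" "\<forall>\<^sub>F s in F. u s \<in> euclid m" "d > 0"
  shows "\<forall>\<^sub>F s in F. u s \<in> ebox m y d"
proof -
  have "\<forall>\<^sub>F s in F. \<forall>i\<in>{..<m}. \<bar>u s i - y i\<bar> < d"
    using assms(1)[THEN tendstoD, OF _ assms(3)]
    by (intro eventually_ball_finite) (auto simp: dist_real_def)
  with assms(2) show ?thesis
    by eventually_elim (auto simp: ebox_def)
qed

section \<open>Locality of partial derivatives and closure of C^k under algebraic operations\<close>

lemma partial_deriv_works:
  "(\<lambda>t. g (x(i := t))) differentiable (at (x i)) \<Longrightarrow>
    ((\<lambda>t. g (x(i := t))) has_real_derivative partial_deriv i g x) (at (x i))"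
  unfolding partial_deriv_def
  by (metis DERIV_deriv_iff_real_differentiable)

text \<open>The filter is \<open>nhds\<close>, not \<open>at\<close>: transferring derivatives also
  requires agreement at the point itself.\<close>

lemma partial_deriv_cong:
  assumes "openin (Euclidean_space m) D" "x \<in> D" "i < m" "\<And>y. y \<in> D \<Longrightarrow> g y = g' y"
  shows "\<forall>\<^sub>F t in nhds (x i). g (x(i := t)) = g' (x(i := t))"
proof -
  obtain e where e: "e > 0" "ebox m x e \<subseteq> D" using openin_contains_ebox assms(1,2) by metis
  have "\<forall>\<^sub>F t in nhds (x i). dist t (x i) < e" 
    using eventually_nhds_metric e(1) by blast
  then show ?thesis
    by (rule eventually_mono)
      (use e(2) assms ebox_upd[OF openin_Euclidean_subset[OF assms(1,2)] assms(3)]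
        in \<open>auto simp: dist_real_def\<close>)
qed


lemma C_k_imp_continuous: "openin (Euclidean_space m) D \<Longrightarrow> C_k k m D g \<Longrightarrow> continuous_on D g"
  by (cases k) (auto simp: continuous_map_Euclidean_subtopology)

lemma C_k_SucD: "C_k (Suc k) m D g \<Longrightarrow> C_k k m D g"
  by (induction k arbitrary: g) auto

lemma C_k_mono:
  assumes "openin (Euclidean_space m) D" "D \<subseteq> D'" "C_k k m D' g"
  shows "C_k k m D g"
  using assms(3)
proof (induction k arbitrary: g)
  case 0
  then show ?case
    using assms(2) by (auto intro: continuous_map_from_subtopology_mono)
next
  case (Suc k)
  then show ?case
    using assms(2) by (auto intro: continuous_map_from_subtopology_mono)
qed

text \<open>Openness is the reason: differentiation at a point of \<open>D\<close> sees only nearby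
  values, all taken in \<open>D\<close>, so the partial derivatives agree on \<open>D\<close> too
  and the induction continues with them.\<close>

lemma C_k_cong:
  assumes D: "openin (Euclidean_space m) D" and "\<And>x. x \<in> D \<Longrightarrow> g x = g' x" and "C_k k m D g"
  shows "C_k k m D g'"
  using assms(2,3)
proof (induction k arbitrary: g g')
  case 0
  then show ?case
    by (simp add: continuous_map_Euclidean_subtopology[OF D] cong: continuous_on_cong)
next
  case (Suc k)
  have cont: "continuous_on D g'"
    using C_k_imp_continuous[OF D Suc.prems(2)] Suc.prems(1) by (metis (no_types, lifting) continuous_on_cong)
  have ev: "\<forall>\<^sub>F t in nhds (x i). g (x(i := t)) = g' (x(i := t))" if "x \<in> D" "i < m" for x i
    using partial_deriv_cong[OF D that Suc.prems(1)] .
  have "(\<lambda>t. g' (x(i := t))) differentiable (at (x i))" if "x \<in> D" "i < m" for x i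
  proof -
    have "(\<lambda>t. g (x(i := t))) differentiable (at (x i))" using Suc.prems(2) that by simp
    then show ?thesis
      using DERIV_cong_ev[OF refl ev[OF that] refl] unfolding real_differentiable_def by blast
  qed
  moreover have "C_k k m D (partial_deriv i g')" if "i < m" for i
  proof (rule Suc.IH)
    show "C_k k m D (partial_deriv i g)" using Suc.prems(2) that by simp
    show "partial_deriv i g x = partial_deriv i g' x" if "x \<in> D" for x
      unfolding partial_deriv_def by (rule deriv_cong_ev[OF ev[OF that \<open>i < m\<close>] refl])
  qed
  ultimately show ?case
    using cont by (simp add: continuous_map_Euclidean_subtopology[OF D])
qed

text \<open>Lets a derivative formula valid on \<open>D\<close> stand in for
  \<open>partial_deriv\<close>, whose values off \<open>D\<close> are arbitrary.\<close>

lemma C_k_SucI: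
  assumes D: "openin (Euclidean_space m) D" and "continuous_on D g"
    and der: "\<And>i x. i < m \<Longrightarrow> x \<in> D \<Longrightarrow> ((\<lambda>t. g (x(i := t))) has_real_derivative g' i x) (at (x i))"
    and C: "\<And>i. i < m \<Longrightarrow> C_k k m D (g' i)"
  shows "C_k (Suc k) m D g"
proof -
  have "C_k k m D (partial_deriv i g)" if "i < m" for i
  proof (rule C_k_cong[OF D _ C[OF that]])
    show "g' i x = partial_deriv i g x" if "x \<in> D" for x
      unfolding partial_deriv_def using DERIV_imp_deriv[OF der[OF \<open>i < m\<close> that]] by simp
  qed
  then show ?thesis
    using assms(2) der by (auto simp: continuous_map_Euclidean_subtopology[OF D] real_differentiable_def)
qed

lemma C_k_SucE:
  assumes "C_k (Suc k) m D g" "i < m"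
  shows "C_k k m D (partial_deriv i g)"
    and "x \<in> D \<Longrightarrow> ((\<lambda>t. g (x(i := t))) has_real_derivative partial_deriv i g x) (at (x i))"
  using assms partial_deriv_works by auto

lemma C_k_const: "C_k k m D (\<lambda>x. c)"
  by (induction k arbitrary: c) (auto simp: partial_deriv_def[abs_def])

lemma C_k_coordinate:
  assumes D: "openin (Euclidean_space m) D"
  shows "C_k k m D (\<lambda>x. x j)"
proof (cases k)
  case 0
  then show ?thesis
    by (auto simp: continuous_map_Euclidean_subtopology[OF D]
        intro: continuous_on_subset[OF continuous_on_product_coordinates])
next
  case (Suc k')
  show ?thesis unfolding Suc
    by (rule C_k_SucI[OF D, where g' = "\<lambda>i x. if i = j then 1 else 0"])
      (auto intro!: derivative_eq_intros C_k_const
        intro: continuous_on_subset[OF continuous_on_product_coordinates])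
qed

lemma C_k_add:
  assumes D: "openin (Euclidean_space m) D" and "C_k k m D f" "C_k k m D g"
  shows "C_k k m D (\<lambda>x. f x + g x)"
  using assms(2,3)
proof (induction k arbitrary: f g)
  case 0
  then show ?case by (auto simp: continuous_map_Euclidean_subtopology[OF D] intro: continuous_intros)
next
  case (Suc k)
  show ?case
  proof (rule C_k_SucI[OF D, where g' = "\<lambda>i x. partial_deriv i f x + partial_deriv i g x"])
    show "continuous_on D (\<lambda>x. f x + g x)"
      by (intro continuous_on_add Suc.prems[THEN C_k_imp_continuous[OF D]])
    fix i assume i: "i < m"
    show "C_k k m D (\<lambda>x. partial_deriv i f x + partial_deriv i g x)"
      by (intro Suc.IH C_k_SucE(1)[OF _ i] Suc.prems)
    show "((\<lambda>t. f (x(i := t)) + g (x(i := t))) has_real_derivative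
        partial_deriv i f x + partial_deriv i g x) (at (x i))" if "x \<in> D" for x
      by (rule DERIV_add[OF Suc.prems[THEN C_k_SucE(2)[OF _ i that]]])
  qed
qed

lemma C_k_mult:
  assumes D: "openin (Euclidean_space m) D" and "C_k k m D f" "C_k k m D g"
  shows "C_k k m D (\<lambda>x. f x * g x)"
  using assms(2,3)
proof (induction k arbitrary: f g)
  case 0
  then show ?case by (auto simp: continuous_map_Euclidean_subtopology[OF D] intro: continuous_intros)
next
  case (Suc k)
  show ?case
  proof (rule C_k_SucI[OF D, where g' = "\<lambda>i x. partial_deriv i f x * g x + partial_deriv i g x * f x"])
    show "continuous_on D (\<lambda>x. f x * g x)"
      by (intro continuous_on_mult Suc.prems[THEN C_k_imp_continuous[OF D]])
    fix i assume i: "i < m"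
    show "C_k k m D (\<lambda>x. partial_deriv i f x * g x + partial_deriv i g x * f x)"
      by (intro Suc.IH C_k_add[OF D] C_k_SucE(1)[OF _ i] Suc.prems C_k_SucD)
    show "((\<lambda>t. f (x(i := t)) * g (x(i := t))) has_real_derivative
        partial_deriv i f x * g x + partial_deriv i g x * f x) (at (x i))" if "x \<in> D" for x
      by (rule DERIV_cong[OF DERIV_mult[OF Suc.prems[THEN C_k_SucE(2)[OF _ i that]]]]) simp
  qed
qed

lemma C_k_sum:
  assumes D: "openin (Euclidean_space m) D" and "\<And>j. j \<in> J \<Longrightarrow> C_k k m D (f j)"
  shows "C_k k m D (\<lambda>x. \<Sum>j\<in>J. f j x)"
  using assms(2)
  by (induction J rule: infinite_finite_induct) (auto intro: C_k_const C_k_add[OF D])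

lemma C_k_inverse:
  assumes D: "openin (Euclidean_space m) D" and "C_k k m D g" and nz: "\<And>x. x \<in> D \<Longrightarrow> g x \<noteq> 0"
  shows "C_k k m D (\<lambda>x. inverse (g x))"
  using assms(2)
proof (induction k)
  case 0
  then show ?case using nz
    by (auto simp: continuous_map_Euclidean_subtopology[OF D] intro!: continuous_on_inverse)
next
  case (Suc k)
  have inv: "C_k k m D (\<lambda>x. inverse (g x))" using Suc C_k_SucD by blast
  show ?case
  \<comment> \<open>The derivative \<open>- g' / g^2\<close> is written as a product of factors
    \<open>inverse (g x)\<close>, which are C^k by the induction hypothesis.\<close>
  proof (rule C_k_SucI[OF D, where g' = "\<lambda>i x. (- 1) * (inverse (g x) * (partial_deriv i g x * inverse (g x)))"])
    show "continuous_on D (\<lambda>x. inverse (g x))"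
      using nz C_k_imp_continuous[OF D Suc.prems] by (auto intro!: continuous_on_inverse)
    fix i assume i: "i < m"
    show "C_k k m D (\<lambda>x. (- 1) * (inverse (g x) * (partial_deriv i g x * inverse (g x))))"
      by (intro C_k_mult[OF D] C_k_const inv C_k_SucE(1)[OF Suc.prems i])
    fix x assume x: "x \<in> D"
    show "((\<lambda>t. inverse (g (x(i := t)))) has_real_derivative
        (- 1) * (inverse (g x) * (partial_deriv i g x * inverse (g x)))) (at (x i))"
      by (rule DERIV_cong[OF DERIV_inverse_fun[OF C_k_SucE(2)[OF Suc.prems i x]]])
        (use nz[OF x] in \<open>simp_all add: field_simps\<close>)
  qed
qed

section \<open>Mean value form of increments and the chain rule\<close>

text \<open>The mean value theorem along coordinate \<open>j\<close> gives a value of the partial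
  derivative at a point squeezed into a small cube about \<open>y\<close>, where that derivative is
  continuous. The product form, unlike a difference quotient, also covers parameters at which
  coordinate \<open>j\<close> does not move.\<close>

lemma partial_mean_value:
  fixes g :: "(nat \<Rightarrow> real) \<Rightarrow> real"
  assumes D: "openin (Euclidean_space m) D" and g: "C_k 1 m D g" and y: "y \<in> D" and j: "j < m"
    and u: "\<And>i. i < m \<Longrightarrow> ((\<lambda>s. u s i) \<longlongrightarrow> y i) F" "\<forall>\<^sub>F s in F. u s \<in> euclid m"
    and t: "(t \<longlongrightarrow> y j) F"
  obtains \<phi> where "(\<phi> \<longlongrightarrow> partial_deriv j g y) F"
    "\<forall>\<^sub>F s in F. g ((u s)(j := t s)) - g (u s) = \<phi> s * (t s - u s j)"
proof
  \<comment> \<open>Where the coordinate does not move, the quotient carries no information; taking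
    the limit itself keeps convergence, and the increment is zero anyway.\<close>
  define \<phi> where "\<phi> s = (if t s = u s j then partial_deriv j g y
    else (g ((u s)(j := t s)) - g (u s)) / (t s - u s j))" for s
  have g': "C_k (Suc 0) m D g" using g by simp
  have u': "\<forall>\<^sub>F s in F. (u s)(j := t s) \<in> euclid m"
    using u(2) by eventually_elim (use j in simp)
  have ut: "((\<lambda>s. ((u s)(j := t s)) i) \<longlongrightarrow> y i) F" if "i < m" for i
    using u(1)[OF that] t by (cases "i = j") auto
  show "\<forall>\<^sub>F s in F. g ((u s)(j := t s)) - g (u s) = \<phi> s * (t s - u s j)"
    by (rule always_eventually) (auto simp: \<phi>_def)
  show "(\<phi> \<longlongrightarrow> partial_deriv j g y) F"
  proof (rule tendstoI)
    fix \<epsilon> :: real assume e: "\<epsilon> > 0"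
    have "C_k 0 m D (partial_deriv j g)" using C_k_SucE(1)[OF g' j] .
    then have "continuous_on D (partial_deriv j g)" by (rule C_k_imp_continuous[OF D])
    from continuous_on_ebox[OF D this y e] obtain d where d: "d > 0" "ebox m y d \<subseteq> D"
      "\<And>z. z \<in> ebox m y d \<Longrightarrow> \<bar>partial_deriv j g z - partial_deriv j g y\<bar> < \<epsilon>" by blast
    have "\<bar>\<phi> s - partial_deriv j g y\<bar> < \<epsilon>"
      if box: "u s \<in> ebox m y d" "(u s)(j := t s) \<in> ebox m y d" for s
    proof (cases "t s = u s j")
      case True
      then show ?thesis using e by (simp add: \<phi>_def)
    next
      case False
      \<comment> \<open>The whole segment between the two points lies in the cube;
        \<open>min\<close> and \<open>max\<close> treat both orders of the endpoints at
        once.\<close>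
      have in_box: "(u s)(j := r) \<in> ebox m y d"
        if "min (u s j) (t s) \<le> r" "r \<le> max (u s j) (t s)" for r
      proof -
        have "\<bar>u s j - y j\<bar> < d" "\<bar>t s - y j\<bar> < d"
          using box j by (auto simp: ebox_def)
        with that have "\<bar>r - y j\<bar> < d" by linarith
        then show ?thesis using box(1) j by (auto simp: ebox_def)
      qed
      have der: "((\<lambda>r. g ((u s)(j := r))) has_real_derivative partial_deriv j g ((u s)(j := r))) (at r)"
        if "min (u s j) (t s) \<le> r" "r \<le> max (u s j) (t s)" for r
        using C_k_SucE(2)[OF g' j, of "(u s)(j := r)"] in_box[OF that] d(2) by auto
      have "min (u s j) (t s) < max (u s j) (t s)" using False by auto
      from MVT2[OF this der] obtain z where z:
        "z > min (u s j) (t s)" "z < max (u s j) (t s)"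
        "g ((u s)(j := max (u s j) (t s))) - g ((u s)(j := min (u s j) (t s)))
          = (max (u s j) (t s) - min (u s j) (t s)) * partial_deriv j g ((u s)(j := z))"
        by blast
      have "g ((u s)(j := t s)) - g (u s) = (t s - u s j) * partial_deriv j g ((u s)(j := z))"
        using z(3) by (cases "u s j \<le> t s") (auto simp: algebra_simps)
      then have "\<phi> s = partial_deriv j g ((u s)(j := z))"
        using False by (simp add: \<phi>_def)
      then show ?thesis using d(3) in_box[of z] z(1,2) by auto
    qed
    then show "\<forall>\<^sub>F s in F. dist (\<phi> s) (partial_deriv j g y) < \<epsilon>"
      using eventually_conj[OF eventually_ebox[OF u d(1)] eventually_ebox[OF ut u' d(1)]]
      by (auto simp: dist_real_def elim!: eventually_mono)
  qed
qed

text \<open>The increment of \<open>F\<close> along the curve is telescoped through the points that have the first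
  \<open>i\<close> coordinates of \<open>c s\<close> and the remaining ones of \<open>c s\<^sub>0\<close>.\<close>

lemma DERIV_compose_curve:
  fixes F :: "(nat \<Rightarrow> real) \<Rightarrow> real" and c :: "real \<Rightarrow> nat \<Rightarrow> real"
  assumes D: "openin (Euclidean_space n) D" and F: "C_k 1 n D F" and y: "c s\<^sub>0 \<in> D"
    and c: "\<forall>\<^sub>F s in at s\<^sub>0. c s \<in> euclid n"
    and der: "\<And>i. i < n \<Longrightarrow> ((\<lambda>s. c s i) has_real_derivative c' i) (at s\<^sub>0)"
  shows "((\<lambda>s. F (c s)) has_real_derivative (\<Sum>i<n. partial_deriv i F (c s\<^sub>0) * c' i)) (at s\<^sub>0)"
proof -
  define z where "z i s l = (if l < i then c s l else c s\<^sub>0 l)" for i s l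
  have lim: "((\<lambda>s. c s i) \<longlongrightarrow> c s\<^sub>0 i) (at s\<^sub>0)" if "i < n" for i
    using DERIV_isCont[OF der[OF that]] by (simp add: isCont_def)
  have z0: "z 0 s = c s\<^sub>0" for s by (auto simp: z_def)
  \<comment> \<open>From index \<open>n\<close> on, \<open>z n s\<close> has the entries of
    \<open>c s\<^sub>0\<close>; they match those of \<open>c s\<close> because both vanish
    there.\<close>
  have zn: "z n s = c s" if "c s \<in> euclid n" for s
    using that openin_Euclidean_subset[OF D y] by (auto simp: z_def euclid_iff)
  have zS: "z (Suc i) s = (z i s)(i := c s i)" for i s by (auto simp: z_def)
  have zlim: "((\<lambda>s. z i s l) \<longlongrightarrow> c s\<^sub>0 l) (at s\<^sub>0)" if "l < n" for i l
    using lim[OF that] by (cases "l < i") (simp_all add: z_def)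
  have ze: "\<forall>\<^sub>F s in at s\<^sub>0. z i s \<in> euclid n" for i
    using c by eventually_elim (use openin_Euclidean_subset[OF D y] in \<open>auto simp: z_def euclid_iff\<close>)
  have "\<exists>\<phi>. (\<phi> \<longlongrightarrow> partial_deriv i F (c s\<^sub>0)) (at s\<^sub>0) \<and>
      (\<forall>\<^sub>F s in at s\<^sub>0. F (z (Suc i) s) - F (z i s) = \<phi> s * (c s i - c s\<^sub>0 i))" if i: "i < n" for i
  proof -
    obtain \<phi> where "(\<phi> \<longlongrightarrow> partial_deriv i F (c s\<^sub>0)) (at s\<^sub>0)"
      "\<forall>\<^sub>F s in at s\<^sub>0. F ((z i s)(i := c s i)) - F (z i s) = \<phi> s * (c s i - z i s i)"
      using partial_mean_value[OF D F y i zlim ze lim[OF i]] by blast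
    then show ?thesis by (auto simp: zS z_def[of i _ i])
  qed
  then have "\<forall>i\<in>{..<n}. \<exists>\<phi>. (\<phi> \<longlongrightarrow> partial_deriv i F (c s\<^sub>0)) (at s\<^sub>0) \<and>
      (\<forall>\<^sub>F s in at s\<^sub>0. F (z (Suc i) s) - F (z i s) = \<phi> s * (c s i - c s\<^sub>0 i))" by blast
  from bchoice[OF this] obtain \<phi> where \<phi>: "\<And>i. i < n \<Longrightarrow> (\<phi> i \<longlongrightarrow> partial_deriv i F (c s\<^sub>0)) (at s\<^sub>0)"
    "\<And>i. i < n \<Longrightarrow> \<forall>\<^sub>F s in at s\<^sub>0. F (z (Suc i) s) - F (z i s) = \<phi> i s * (c s i - c s\<^sub>0 i)"
    by blast
  have "((\<lambda>s. \<Sum>i<n. \<phi> i s * ((c s i - c s\<^sub>0 i) / (s - s\<^sub>0))) \<longlongrightarrow>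
      (\<Sum>i<n. partial_deriv i F (c s\<^sub>0) * c' i)) (at s\<^sub>0)"
    using der by (intro tendsto_sum tendsto_mult \<phi>(1)) (auto simp: has_field_derivative_iff)
  moreover have "\<forall>\<^sub>F s in at s\<^sub>0. \<forall>i\<in>{..<n}. F (z (Suc i) s) - F (z i s) = \<phi> i s * (c s i - c s\<^sub>0 i)"
    by (rule eventually_ball_finite) (auto intro: \<phi>(2))
  then have "\<forall>\<^sub>F s in at s\<^sub>0. (\<Sum>i<n. \<phi> i s * ((c s i - c s\<^sub>0 i) / (s - s\<^sub>0)))
      = (F (c s) - F (c s\<^sub>0)) / (s - s\<^sub>0)"
    using c
  proof eventually_elim
    case (elim s)
    have "F (c s) - F (c s\<^sub>0) = (\<Sum>i<n. F (z (Suc i) s) - F (z i s))"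
      using sum_lessThan_telescope[of "\<lambda>i. F (z i s)" n]
      by (simp add: z0 zn[OF elim(2)])
    also have "\<dots> = (\<Sum>i<n. \<phi> i s * (c s i - c s\<^sub>0 i))" using elim(1) by simp
    finally show ?case by (simp add: sum_divide_distrib)
  qed
  ultimately show ?thesis
    unfolding has_field_derivative_iff by (rule Lim_transform_eventually)
qed

section \<open>Continuity, open preimages and composition\<close>

lemma continuous_on_euclidI:
  fixes f :: "'a :: topological_space \<Rightarrow> nat \<Rightarrow> real"
  assumes "\<And>i. i < n \<Longrightarrow> continuous_on D (\<lambda>x. f x i)" "f ` D \<subseteq> euclid n"
  shows "continuous_on D f"
proof (intro continuous_on_coordinatewise_then_product)
  show "continuous_on D (\<lambda>x. f x i)" for i
  proof (cases "i < n")
    case False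
    then have "f x i = 0" if "x \<in> D" for x
      using that assms(2) by (force simp: euclid_iff)
    then show ?thesis by (simp cong: continuous_on_cong)
  qed (rule assms(1))
qed

lemma continuous_on_compose_euclid:
  fixes f :: "'a :: topological_space \<Rightarrow> nat \<Rightarrow> real"
  assumes "\<And>i. i < n \<Longrightarrow> continuous_on D (\<lambda>x. f x i)" "f ` D \<subseteq> B" "B \<subseteq> euclid n"
    and "continuous_on B F"
  shows "continuous_on D (\<lambda>x. F (f x))"
  using assms by (intro continuous_on_compose2[OF assms(4) _ assms(2)] continuous_on_euclidI[where n = n]) auto

lemma openin_preimage_euclid:
  fixes f :: "(nat \<Rightarrow> real) \<Rightarrow> nat \<Rightarrow> real"
  assumes "openin (Euclidean_space m) D" "\<And>i. i < n \<Longrightarrow> continuous_on D (\<lambda>x. f x i)"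
    and "f ` D \<subseteq> euclid n" "openin (Euclidean_space n) B"
  shows "openin (Euclidean_space m) {x \<in> D. f x \<in> B}"
proof -
  obtain T where T: "open T" "B = euclid n \<inter> T"
    using assms(4) unfolding openin_Euclidean_space_iff by blast
  obtain T1 where T1: "open T1" "D = euclid m \<inter> T1"
    using assms(1) unfolding openin_Euclidean_space_iff by blast
  have "openin (top_of_set D) (D \<inter> f -` T)"
    using continuous_openin_preimage_gen[OF continuous_on_euclidI[OF assms(2,3)] T(1)] by blast
  then obtain T2 where T2: "open T2" "D \<inter> f -` T = D \<inter> T2"
    unfolding openin_open by blast
  have "{x \<in> D. f x \<in> B} = euclid m \<inter> (T1 \<inter> T2)"
    using assms(3) T(2) T1(2) T2(2) by blast
  then show ?thesis
    unfolding openin_Euclidean_space_iff using T1(1) T2(1) by blast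
qed

lemma openin_Euclidean_positive:
  fixes f :: "(nat \<Rightarrow> real) \<Rightarrow> real"
  assumes "openin (Euclidean_space m) D" "continuous_on D f"
  shows "openin (Euclidean_space m) {x \<in> D. f x > 0}"
proof -
  obtain T1 where T1: "open T1" "D = euclid m \<inter> T1"
    using assms(1) unfolding openin_Euclidean_space_iff by blast
  obtain T2 where T2: "open T2" "D \<inter> f -` {0<..} = D \<inter> T2"
    using continuous_openin_preimage_gen[OF assms(2), of "{0<..}"] unfolding openin_open by auto
  have "{x \<in> D. f x > 0} = euclid m \<inter> (T1 \<inter> T2)"
    using T1(2) T2(2) by auto
  then show ?thesis
    unfolding openin_Euclidean_space_iff using T1(1) T2(1) by blast
qed

lemma eventually_upd_in:
  assumes D: "openin (Euclidean_space m) D" "x \<in> D" "l < m"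
  shows "\<forall>\<^sub>F s in at (x l). x(l := s) \<in> D"
proof -
  obtain e where e: "e > 0" "ebox m x e \<subseteq> D" using openin_contains_ebox[OF D(1,2)] .
  have "\<forall>\<^sub>F s in at (x l). \<bar>s - x l\<bar> < e"
    using e(1) by (auto simp: eventually_at dist_real_def)
  then show ?thesis
    by eventually_elim (use e(2) ebox_upd[OF openin_Euclidean_subset[OF D(1,2)] D(3)] in blast)
qed

lemma tendsto_upd:
  fixes h :: "(nat \<Rightarrow> real) \<Rightarrow> real"
  assumes D: "openin (Euclidean_space m) D" "x \<in> D" "l < m" and h: "continuous_on D h"
  shows "((\<lambda>s. h (x(l := s))) \<longlongrightarrow> h x) (at (x l))"
proof (rule tendstoI)
  fix \<epsilon> :: real assume "\<epsilon> > 0"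
  with continuous_on_ebox[OF D(1) h D(2)] obtain d where d: "d > 0"
    "\<And>y. y \<in> ebox m x d \<Longrightarrow> \<bar>h y - h x\<bar> < \<epsilon>" by metis
  have "\<forall>\<^sub>F s in at (x l). x(l := s) \<in> ebox m x d"
    by (rule eventually_upd_in[OF openin_ebox center_in_ebox[OF openin_Euclidean_subset[OF D(1,2)] d(1)] D(3)])
  then show "\<forall>\<^sub>F s in at (x l). dist (h (x(l := s))) (h x) < \<epsilon>"
    by eventually_elim (use d(2) in \<open>simp add: dist_real_def\<close>)
qed

text \<open>\<open>f\<close> turns the coordinate line through \<open>x\<close> into a curve, to
  which \<open>DERIV_compose_curve\<close> applies.\<close>

lemma partial_compose:
  assumes D: "openin (Euclidean_space m) D" and B: "openin (Euclidean_space n) B"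
    and f: "f ` D \<subseteq> B" "\<And>i. i < n \<Longrightarrow> C_k 1 m D (\<lambda>x. f x i)" and F: "C_k 1 n B F"
    and x: "x \<in> D" and j: "j < m"
  shows "((\<lambda>t. F (f (x(j := t)))) has_real_derivative
    (\<Sum>i<n. partial_deriv i F (f x) * partial_deriv j (\<lambda>x. f x i) x)) (at (x j))"
proof -
  have "\<forall>\<^sub>F t in at (x j). f (x(j := t)) \<in> euclid n"
    using eventually_upd_in[OF D x j] by eventually_elim (use f(1) openin_subset[OF B] in blast)
  moreover have "((\<lambda>t. f (x(j := t)) i) has_real_derivative partial_deriv j (\<lambda>x. f x i) x) (at (x j))"
    if "i < n" for i
    by (rule C_k_SucE(2)[OF _ j x, where k = 0]) (use f(2)[OF that] in simp)
  ultimately show ?thesis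
    using DERIV_compose_curve[OF B F, of "\<lambda>t. f (x(j := t))" "x j"] f(1) x by auto
qed

text \<open>The induction keeps \<open>f\<close> fixed and varies \<open>F\<close>: by the chain
  rule a partial derivative is a sum of products of \<open>partial_deriv i F (f x)\<close>, again a
  composite with \<open>f\<close>, and partial derivatives of \<open>f\<close>.\<close>

lemma C_k_compose:
  assumes D: "openin (Euclidean_space m) D" and B: "openin (Euclidean_space n) B"
    and f: "f ` D \<subseteq> B" "\<And>i. i < n \<Longrightarrow> C_k k m D (\<lambda>x. f x i)" and F: "C_k k n B F"
  shows "C_k k m D (\<lambda>x. F (f x))"
  using f(2) F
proof (induction k arbitrary: F)
  case 0
  have "continuous_on D (\<lambda>x. F (f x))"
    by (rule continuous_on_compose_euclid[OF 0(1)[THEN C_k_imp_continuous[OF D]] f(1)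
          openin_subset[OF B] 0(2)[THEN C_k_imp_continuous[OF B]]])
  then show ?case by (simp add: continuous_map_Euclidean_subtopology[OF D])
next
  case (Suc k)
  have C1: "C_k (Suc 0) m' D' h" if "C_k (Suc k) m' D' h" for m' D' h
    using that by (induction k) (auto dest: C_k_SucD)
  show ?case
  proof (rule C_k_SucI[OF D, where g' = "\<lambda>j x. \<Sum>i<n. partial_deriv i F (f x) * partial_deriv j (\<lambda>x. f x i) x"])
    show "continuous_on D (\<lambda>x. F (f x))"
      by (rule continuous_on_compose_euclid[OF Suc.prems(1)[THEN C_k_imp_continuous[OF D]] f(1)
            openin_subset[OF B] Suc.prems(2)[THEN C_k_imp_continuous[OF B]]])
    fix j assume j: "j < m"
    show "C_k k m D (\<lambda>x. \<Sum>i<n. partial_deriv i F (f x) * partial_deriv j (\<lambda>x. f x i) x)"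
    proof (intro C_k_sum[OF D] C_k_mult[OF D])
      fix i assume "i \<in> {..<n}"
      then have i: "i < n" by simp
      show "C_k k m D (\<lambda>x. partial_deriv i F (f x))"
        by (rule Suc.IH[OF C_k_SucD[OF Suc.prems(1)] C_k_SucE(1)[OF Suc.prems(2) i]])
      show "C_k k m D (partial_deriv j (\<lambda>x. f x i))"
        by (rule C_k_SucE(1)[OF Suc.prems(1)[OF i] j])
    qed
    show "((\<lambda>t. F (f (x(j := t)))) has_real_derivative
        (\<Sum>i<n. partial_deriv i F (f x) * partial_deriv j (\<lambda>x. f x i) x)) (at (x j))" if "x \<in> D" for x
      using partial_compose[OF D B f(1) _ _ that j] C1 Suc.prems by simp
  qed
qed

section \<open>Local sections of submersions between Cartesian spaces\<close>

text \<open>Entry \<open>j\<close> of \<open>x\<close> serves as the value prescribed for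
  \<open>g\<close>, so \<open>x(j := h x)\<close> is a right inverse of the map that replaces
  coordinate \<open>j\<close> by \<open>g\<close>. Near \<open>a\<close> the function
  \<open>g\<close> is strictly monotone in coordinate \<open>j\<close>: this gives existence,
  uniqueness and continuity of the root. The derivative is stated for the Jacobian computation in
  Dini's induction.\<close>

lemma implicit_coordinate:
  fixes g :: "(nat \<Rightarrow> real) \<Rightarrow> real"
  assumes D: "openin (Euclidean_space m) D" and g: "\<And>k. C_k k m D g"
    and a: "a \<in> D" and j: "j < m" and nz: "partial_deriv j g a \<noteq> 0"
  obtains D' h where "openin (Euclidean_space m) D'" "a(j := g a) \<in> D'" "h (a(j := g a)) = a j"
    "\<And>x. x \<in> D' \<Longrightarrow> x(j := h x) \<in> D" "\<And>x. x \<in> D' \<Longrightarrow> g (x(j := h x)) = x j"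
    "\<And>k. C_k k m D' h"
    "\<And>x l. x \<in> D' \<Longrightarrow> l < m \<Longrightarrow> ((\<lambda>t. h (x(l := t))) has_real_derivative
        (if l = j then 1 else - partial_deriv l g (x(j := h x))) *
          inverse (partial_deriv j g (x(j := h x)))) (at (x l))"
proof -
  define c where "c = partial_deriv j g"
  have g1: "C_k (Suc 0) m D g" by (rule g)
  have Cc: "C_k k m D c" for k unfolding c_def by (rule C_k_SucE(1)[OF g j])
  have nz': "\<bar>c a\<bar> > 0" using nz by (simp add: c_def)
  from continuous_on_ebox[OF D C_k_imp_continuous[OF D Cc] a nz'] obtain e0 where
    e0: "e0 > 0" "ebox m a e0 \<subseteq> D" "\<And>y. y \<in> ebox m a e0 \<Longrightarrow> \<bar>c y - c a\<bar> < \<bar>c a\<bar>" by blast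
  \<comment> \<open>Half the radius, so that the endpoints \<open>a j - e\<close> and
    \<open>a j + e\<close> still lie strictly inside the cube where the derivative is
    controlled.\<close>
  define e where "e = e0 / 2"
  have e: "0 < e" "e < e0" using e0(1) by (auto simp: e_def)
  \<comment> \<open>A deviation smaller than \<open>\<bar>c a\<bar>\<close> cannot change the sign
    of the derivative.\<close>
  have pos: "c a * c y > 0" if "y \<in> ebox m a e0" for y
    using e0(3)[OF that] by (auto simp: zero_less_mult_iff)
  have ae: "a \<in> euclid m" using openin_Euclidean_subset[OF D a] .
  \<comment> \<open>Entry \<open>j\<close> of \<open>x\<close> is left free here: it is a prescribed
    value of \<open>g\<close>, not a coordinate of a point at which \<open>g\<close> is
    evaluated.\<close>
  define N where "N = {x \<in> euclid m. x(j := a j) \<in> ebox m a e0}"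
  have N_upd: "x(j := t) \<in> ebox m a e0" if "x \<in> N" "\<bar>t - a j\<bar> < e0" for x t
    using that j by (auto simp: N_def ebox_def split: if_splits)
  have upd_cont: "continuous_on B (\<lambda>x. (x(j := t)) i)" for B i and t :: real
    by (cases "i = j") (auto intro: continuous_on_subset[OF continuous_on_product_coordinates])
  have N: "openin (Euclidean_space m) N"
    unfolding N_def by (rule openin_preimage_euclid[where f = "\<lambda>x. x(j := a j)", OF _ upd_cont]) (use j openin_ebox in auto)
  \<comment> \<open>The factor \<open>c a\<close> makes \<open>G x\<close> strictly increasing
    whichever sign the partial derivative has.\<close>
  define G where "G x t = c a * (g (x(j := t)) - x j)" for x t
  have G_cont: "continuous_on N (\<lambda>x. G x t)" if "\<bar>t - a j\<bar> < e0" for t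
    unfolding G_def
    by (intro continuous_on_mult continuous_on_const continuous_on_diff
        continuous_on_compose_euclid[where f = "\<lambda>x. x(j := t)", OF upd_cont _ openin_subset[OF D] C_k_imp_continuous[OF D g[of 0]]]
        continuous_on_subset[OF continuous_on_product_coordinates])
      (use N_upd[OF _ that] e0(2) in auto)
  have G_der: "((\<lambda>t. G x t) has_real_derivative c a * c (x(j := t))) (at t)"
    if "x \<in> N" "\<bar>t - a j\<bar> < e0" for x t
  proof -
    have "((\<lambda>s. g ((x(j := t))(j := s))) has_real_derivative c (x(j := t))) (at ((x(j := t)) j))"
      unfolding c_def using N_upd[OF that] e0(2) by (intro C_k_SucE(2)[OF g1 j]) auto
    then have "((\<lambda>s. g (x(j := s))) has_real_derivative c (x(j := t))) (at t)" by simp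
    from DERIV_cmult[OF DERIV_diff[OF this DERIV_const]] show ?thesis
      unfolding G_def by simp
  qed
  have G_mono: "G x t1 < G x t2"
    if "x \<in> N" "t1 < t2" "\<bar>t1 - a j\<bar> < e0" "\<bar>t2 - a j\<bar> < e0" for x t1 t2
  proof (rule DERIV_pos_imp_increasing[OF that(2)])
    fix t assume "t1 \<le> t" "t \<le> t2"
    then have t: "\<bar>t - a j\<bar> < e0" using that(3,4) by linarith
    show "\<exists>y. ((\<lambda>t. G x t) has_real_derivative y) (at t) \<and> y > 0"
      using G_der[OF that(1) t] pos[OF N_upd[OF that(1) t]] by blast
  qed
  \<comment> \<open>Opposite strict signs at the endpoints force a root strictly between them, and
    they persist under small changes of \<open>x\<close>. Both are phrased as positivity to fit
    \<open>openin_Euclidean_positive\<close>.\<close>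
  define D' where "D' = {x \<in> {x \<in> N. G x (a j + e) > 0}. - G x (a j - e) > 0}"
  have between: "openin (Euclidean_space m) {x \<in> {x \<in> B. G x t2 > 0}. - G x t1 > 0}"
    if "openin (Euclidean_space m) B" "B \<subseteq> N" "\<bar>t1 - a j\<bar> < e0" "\<bar>t2 - a j\<bar> < e0" for B t1 t2
    by (intro openin_Euclidean_positive that(1) continuous_on_minus)
      (rule continuous_on_subset[OF G_cont], use that in auto)+
  have D': "openin (Euclidean_space m) D'"
    unfolding D'_def by (rule between[OF N]) (use e in auto)
  have D'N: "D' \<subseteq> N" by (auto simp: D'_def)
  define h where "h x = (THE t. \<bar>t - a j\<bar> < e \<and> G x t = 0)" for x
  have h_eqI: "h x = t" if "x \<in> N" "\<bar>t - a j\<bar> < e" "G x t = 0" for x t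
    unfolding h_def
  proof (rule the_equality)
    show "t' = t" if t': "\<bar>t' - a j\<bar> < e \<and> G x t' = 0" for t'
      using G_mono[OF \<open>x \<in> N\<close>, of t t'] G_mono[OF \<open>x \<in> N\<close>, of t' t] t' \<open>\<bar>t - a j\<bar> < e\<close>
        \<open>G x t = 0\<close> e(2) by (cases t t' rule: linorder_cases) auto
  qed (use that in simp)
  have h: "\<bar>h x - a j\<bar> < e" "G x (h x) = 0" if x: "x \<in> D'" for x
  proof -
    have "\<exists>t\<ge>a j - e. t \<le> a j + e \<and> G x t = 0"
    proof (rule IVT)
      show "G x (a j - e) \<le> 0" "0 \<le> G x (a j + e)" "a j - e \<le> a j + e"
        using x e by (auto simp: D'_def)
      show "\<forall>t. a j - e \<le> t \<and> t \<le> a j + e \<longrightarrow> isCont (G x) t"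
        using DERIV_isCont[OF G_der] x D'N e(2) by (auto simp: abs_le_iff)
    qed
    then obtain t where t: "a j - e \<le> t" "t \<le> a j + e" "G x t = 0" by blast
    then have "t \<noteq> a j - e" "t \<noteq> a j + e" using x by (auto simp: D'_def)
    with t have "\<bar>t - a j\<bar> < e" by linarith
    with h_eqI[of x t] t(3) x D'N show "\<bar>h x - a j\<bar> < e" "G x (h x) = 0" by auto
  qed
  have in_D: "x(j := h x) \<in> D" and c_nz: "c (x(j := h x)) \<noteq> 0" if "x \<in> D'" for x
    using N_upd[of x "h x"] h(1)[OF that] e(2) e0(2) pos[of "x(j := h x)"] that D'N by auto
  have gh: "g (x(j := h x)) = x j" if "x \<in> D'" for x
    using h(2)[OF that] nz' by (simp add: G_def)
  have "continuous_on D' h"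
  proof (rule continuous_on_eboxI[OF D'])
    fix x and \<epsilon> :: real assume x: "x \<in> D'" and \<epsilon>: "\<epsilon> > 0"
    \<comment> \<open>Points on both sides of the root within \<open>\<epsilon>\<close>, clipped to
      the window where \<open>G\<close> is monotone. The signs of \<open>G\<close> there persist for
      nearby \<open>y\<close> and trap \<open>h y\<close> between them.\<close>
    define t1 t2 where "t1 = max (h x - \<epsilon> / 2) (a j - e)" and "t2 = min (h x + \<epsilon> / 2) (a j + e)"
    have t: "t1 < h x" "h x < t2" "\<bar>t1 - a j\<bar> < e0" "\<bar>t2 - a j\<bar> < e0" "h x - \<epsilon> < t1" "t2 < h x + \<epsilon>"
      using h(1)[OF x] \<epsilon> e unfolding t1_def t2_def by linarith+
    have hx: "\<bar>h x - a j\<bar> < e0" using h(1)[OF x] e by linarith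
    have xN: "x \<in> N" using x D'N by blast
    have "G x t1 < 0" "0 < G x t2"
      using G_mono[OF xN t(1) t(3) hx] G_mono[OF xN t(2) hx t(4)] h(2)[OF x] by simp_all
    then have "x \<in> {x \<in> {x \<in> D'. G x t2 > 0}. - G x t1 > 0}" using x by simp
    from openin_contains_ebox[OF between[OF D' D'N t(3,4)] this] obtain d where
      d: "d > 0" "ebox m x d \<subseteq> {x \<in> {x \<in> D'. G x t2 > 0}. - G x t1 > 0}" by blast
    have "\<bar>h y - h x\<bar> < \<epsilon>" if "y \<in> ebox m x d" for y
    proof -
      have y: "y \<in> D'" "G y t1 < 0" "0 < G y t2" using that d(2) by auto
      have hy: "\<bar>h y - a j\<bar> < e0" "G y (h y) = 0" using h[OF y(1)] e by auto
      have yN: "y \<in> N" using y(1) D'N by blast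
      have "t1 < h y"
        using G_mono[OF yN _ hy(1) t(3)] y(2) hy(2) by (cases "h y" t1 rule: linorder_cases) auto
      moreover have "h y < t2"
        using G_mono[OF yN _ t(4) hy(1)] y(3) hy(2) by (cases "h y" t2 rule: linorder_cases) auto
      ultimately show ?thesis using t(5,6) by linarith
    qed
    with d(1) show "\<exists>d>0. \<forall>y\<in>ebox m x d. y \<in> D' \<longrightarrow> \<bar>h y - h x\<bar> < \<epsilon>" by blast
  qed
  note h_cont = this
  have h_der: "((\<lambda>t. h (x(l := t))) has_real_derivative
        (if l = j then 1 else - partial_deriv l g (x(j := h x))) * inverse (c (x(j := h x)))) (at (x l))"
    if x: "x \<in> D'" and l: "l < m" for x l
  proof -
    define y where "y = x(j := h x)"
    \<comment> \<open>Coordinate \<open>j\<close> is frozen at \<open>h x\<close>. Resetting it to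
      \<open>h (x(l := s))\<close> gives the solution point for \<open>x(l := s)\<close>, where
      \<open>g\<close> is known; the increment of \<open>g\<close> in coordinate \<open>j\<close>
      thus measures the change of \<open>h\<close>.\<close>
    define u where "u s = x(l := s, j := h x)" for s
    have y: "y \<in> D" using in_D[OF x] by (simp add: y_def)
    have xe: "x \<in> euclid m" using openin_Euclidean_subset[OF D' x] .
    have "((\<lambda>s. u s i) \<longlongrightarrow> y i) (at (x l))" for i
      by (cases "i = l"; cases "i = j") (auto simp: u_def y_def intro!: tendsto_eq_intros)
    moreover have "\<forall>\<^sub>F s in at (x l). u s \<in> euclid m"
      using xe l j by (simp add: u_def)
    moreover have "((\<lambda>s. h (x(l := s))) \<longlongrightarrow> y j) (at (x l))"
      using tendsto_upd[OF D' x l h_cont] by (simp add: y_def)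
    ultimately obtain \<phi> where \<phi>: "(\<phi> \<longlongrightarrow> c y) (at (x l))"
      "\<forall>\<^sub>F s in at (x l). g ((u s)(j := h (x(l := s)))) - g (u s) = \<phi> s * (h (x(l := s)) - u s j)"
      using partial_mean_value[OF D _ y j, of g u "at (x l)" "\<lambda>s. h (x(l := s))"] g1
      unfolding c_def by auto
    \<comment> \<open>For \<open>l = j\<close> the point \<open>u s\<close> is constant and only the
      prescribed value moves, at rate 1; for \<open>l \<noteq> j\<close> the prescribed value is
      constant and \<open>g (u s)\<close> moves.\<close>
    have lim: "((\<lambda>s. ((x(l := s)) j - g (u s)) / (s - x l)) \<longlongrightarrow>
        (if l = j then 1 else - partial_deriv l g y)) (at (x l))"
    proof (cases "l = j")
      case True
      have "\<forall>\<^sub>F s in at (x l). (1::real) = ((x(l := s)) j - g (u s)) / (s - x l)"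
        using gh[OF x] True by (auto simp: u_def eventually_at intro!: exI[of _ 1])
      then show ?thesis using True by (auto intro: Lim_transform_eventually[OF tendsto_const])
    next
      case False
      then have yl: "y l = x l" "y(l := x l) = y" by (auto simp: y_def)
      have "((\<lambda>s. g (y(l := s))) has_real_derivative partial_deriv l g y) (at (y l))"
        by (rule C_k_SucE(2)[OF g1 l y])
      then have "((\<lambda>s. (g (y(l := s)) - g y) / (s - x l)) \<longlongrightarrow> partial_deriv l g y) (at (x l))"
        using False yl by (simp add: has_field_derivative_iff)
      from tendsto_minus[OF this] show ?thesis
        using False gh[OF x] by (simp add: u_def y_def fun_upd_twist[of j l] minus_divide_left)
    qed
    have nzy: "c y \<noteq> 0" using c_nz[OF x] by (simp add: y_def)
    have "\<forall>\<^sub>F s in at (x l). \<phi> s \<noteq> 0"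
      using tendsto_imp_eventually_ne[OF \<phi>(1) nzy] .
    with \<phi>(2) eventually_upd_in[OF D' x l]
    have "\<forall>\<^sub>F s in at (x l). ((x(l := s)) j - g (u s)) / (s - x l) * inverse (\<phi> s)
        = (h (x(l := s)) - h x) / (s - x l)"
    proof eventually_elim
      case (elim s)
      have eq: "(x(l := s)) j - g (u s) = \<phi> s * (h (x(l := s)) - h x)"
        using elim(1) gh[OF elim(2)] by (simp add: u_def)
      show ?case unfolding eq using elim(3) by simp
    qed
    with tendsto_mult[OF lim tendsto_inverse[OF \<phi>(1) nzy]] show ?thesis
      unfolding has_field_derivative_iff y_def[symmetric] fun_upd_triv
      by (rule Lim_transform_eventually)
  qed
  have "C_k k m D' h" for k
  proof (induction k)
    case 0
    then show ?case using h_cont by (simp add: continuous_map_Euclidean_subtopology[OF D'])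
  next
    case (Suc k)
    \<comment> \<open>The bootstrap: the derivative formula contains \<open>h\<close> only
      undifferentiated, inside \<open>x(j := h x)\<close>, so C^k for \<open>h\<close> makes the
      derivative C^k as well.\<close>
    have C: "C_k k m D' (\<lambda>x. F (x(j := h x)))" if "C_k k m D F" for F
    proof (rule C_k_compose[OF D' D _ _ that])
      show "C_k k m D' (\<lambda>x. (x(j := h x)) i)" for i
        using Suc C_k_coordinate[OF D'] by (cases "i = j") auto
    qed (use in_D in auto)
    show ?case
    proof (rule C_k_SucI[OF D' h_cont h_der])
      show "C_k k m D' (\<lambda>x. (if l = j then 1 else - partial_deriv l g (x(j := h x)))
          * inverse (c (x(j := h x))))" if l: "l < m" for l
      proof (rule C_k_mult[OF D'])
        show "C_k k m D' (\<lambda>x. inverse (c (x(j := h x))))"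
          using c_nz by (intro C_k_inverse[OF D'] C Cc)
        have "C_k k m D' (\<lambda>x. - 1 * partial_deriv l g (x(j := h x)))"
          by (intro C_k_mult[OF D'] C_k_const C C_k_SucE(1)[OF g l])
        then show "C_k k m D' (\<lambda>x. if l = j then 1 else - partial_deriv l g (x(j := h x)))"
          using C_k_const by (cases "l = j") auto
      qed
    qed
  qed
  moreover have "a(j := g a) \<in> N" "G (a(j := g a)) (a j) = 0"
    using ae j center_in_ebox[OF ae e0(1)] by (auto simp: N_def G_def)
  moreover from this have "a(j := g a) \<in> D'" "h (a(j := g a)) = a j"
    using G_mono[of "a(j := g a)" "a j - e" "a j"] G_mono[of "a(j := g a)" "a j" "a j + e"] e
    by (auto simp: D'_def intro: h_eqI)
  ultimately show ?thesis
    using that[of D' h] D' in_D gh h_der unfolding c_def by blast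
qed

section \<open>Smooth maps between Cartesian spaces and their Jacobians\<close>

lemma smooth_euclidean_openin: "smooth_euclidean m n D f \<Longrightarrow> openin (Euclidean_space m) D"
  and smooth_euclidean_image: "smooth_euclidean m n D f \<Longrightarrow> f ` D \<subseteq> euclid n"
  and smooth_euclidean_C_k: "smooth_euclidean m n D f \<Longrightarrow> i < n \<Longrightarrow> C_k k m D (\<lambda>x. f x i)"
  by (auto simp: smooth_euclidean_def)

lemma smooth_euclideanI:
  assumes "openin (Euclidean_space m) D" "f ` D \<subseteq> euclid n"
    and "\<And>i k. i < n \<Longrightarrow> C_k k m D (\<lambda>x. f x i)"
  shows "smooth_euclidean m n D f"
  using assms by (auto simp: smooth_euclidean_def)

lemma smooth_euclidean_subset:
  assumes "smooth_euclidean m n D f" "openin (Euclidean_space m) D'" "D' \<subseteq> D"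
  shows "smooth_euclidean m n D' f"
  using assms smooth_euclidean_image[OF assms(1)]
  by (intro smooth_euclideanI) (auto intro: C_k_mono smooth_euclidean_C_k)

lemma smooth_euclidean_cong:
  assumes f: "smooth_euclidean m n D f" and "\<And>x. x \<in> D \<Longrightarrow> f x = f' x"
  shows "smooth_euclidean m n D f'"
proof (rule smooth_euclideanI)
  show "C_k k m D (\<lambda>x. f' x i)" if "i < n" for i k
    using C_k_cong[OF smooth_euclidean_openin[OF f] _ smooth_euclidean_C_k[OF f that]] assms(2)
    by simp
qed (use assms smooth_euclidean_image smooth_euclidean_openin in force)+

lemma smooth_euclidean_openin_preimage:
  assumes f: "smooth_euclidean m n D f" and B: "openin (Euclidean_space n) B"
  shows "openin (Euclidean_space m) {x \<in> D. f x \<in> B}"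
  by (rule openin_preimage_euclid[OF smooth_euclidean_openin[OF f] _ smooth_euclidean_image[OF f] B])
    (rule C_k_imp_continuous[OF smooth_euclidean_openin[OF f] smooth_euclidean_C_k[OF f]])

lemma smooth_euclidean_compose:
  assumes f: "smooth_euclidean m n D f" and F: "smooth_euclidean n p B F" and fD: "f ` D \<subseteq> B"
  shows "smooth_euclidean m p D (F \<circ> f)"
proof (rule smooth_euclideanI[OF smooth_euclidean_openin[OF f]])
  show "(F \<circ> f) ` D \<subseteq> euclid p" using smooth_euclidean_image[OF F] fD by auto
  show "C_k k m D (\<lambda>x. (F \<circ> f) x i)" if "i < p" for i k
    unfolding o_def
    by (rule C_k_compose[OF smooth_euclidean_openin[OF f] smooth_euclidean_openin[OF F] fD
          smooth_euclidean_C_k[OF f] smooth_euclidean_C_k[OF F that]])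
qed

lemma jacobian_map_in_euclid: "jacobian_map m n f a v \<in> euclid n"
  by (simp add: jacobian_map_def euclid_iff)

text \<open>The chain rule in matrix form; through it surjectivity of the differential survives a
  change of coordinates.\<close>

lemma jacobian_map_compose:
  assumes f: "smooth_euclidean m n D f" and F: "smooth_euclidean n p B F" and fD: "f ` D \<subseteq> B"
    and x: "x \<in> D"
  shows "jacobian_map m p (F \<circ> f) x v = jacobian_map n p F (f x) (jacobian_map m n f x v)"
proof
  fix i
  show "jacobian_map m p (F \<circ> f) x v i = jacobian_map n p F (f x) (jacobian_map m n f x v) i"
  proof (cases "i < p")
    case True
    have "partial_deriv j (\<lambda>y. (F \<circ> f) y i) x =
        (\<Sum>k<n. partial_deriv k (\<lambda>y. F y i) (f x) * partial_deriv j (\<lambda>y. f y k) x)" if "j < m" for j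
      unfolding o_def partial_deriv_def[of j "\<lambda>y. F (f y) i"]
      by (rule DERIV_imp_deriv, rule partial_compose[OF smooth_euclidean_openin[OF f]
            smooth_euclidean_openin[OF F] fD smooth_euclidean_C_k[OF f] smooth_euclidean_C_k[OF F True] x that])
    then have "(\<Sum>j<m. partial_deriv j (\<lambda>y. (F \<circ> f) y i) x * v j) =
        (\<Sum>j<m. \<Sum>k<n. partial_deriv k (\<lambda>y. F y i) (f x) * (partial_deriv j (\<lambda>y. f y k) x * v j))"
      by (simp add: sum_distrib_right mult.assoc)
    also have "\<dots> = (\<Sum>k<n. partial_deriv k (\<lambda>y. F y i) (f x) * (\<Sum>j<m. partial_deriv j (\<lambda>y. f y k) x * v j))"
      by (subst sum.swap) (simp add: sum_distrib_left)
    finally show ?thesis using True by (simp add: jacobian_map_def)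
  qed (simp add: jacobian_map_def)
qed

text \<open>Dini's induction: the equations \<open>f\<^sub>i (S x) = x (J i)\<close> for \<open>i < k\<close> say that \<open>S\<close> is a change
  of coordinates in which the first \<open>k\<close> components of \<open>f\<close> are coordinates. Since the differential
  stays onto, the next component depends on a coordinate not yet used, and replacing that coordinate
  by the component costs one scalar implicit function.\<close>

lemma components_as_coordinates:
  assumes f: "smooth_euclidean m n D f" and a: "a \<in> D"
    and onto: "jacobian_map m n f a ` euclid m = euclid n" and "k \<le> n"
  shows "\<exists>D' S b J. smooth_euclidean m m D' S \<and> S ` D' \<subseteq> D \<and> b \<in> D' \<and> S b = a \<and>
    inj_on J {..<k} \<and> J ` {..<k} \<subseteq> {..<m} \<and> (\<forall>x\<in>D'. \<forall>i<k. f (S x) i = x (J i)) \<and>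
    jacobian_map m n (f \<circ> S) b ` euclid m = euclid n"
  using \<open>k \<le> n\<close>
proof (induction k)
  case 0
  have D: "openin (Euclidean_space m) D" using smooth_euclidean_openin[OF f] .
  have "smooth_euclidean m m D (\<lambda>x. x)"
    using openin_subset[OF D] by (intro smooth_euclideanI D C_k_coordinate) auto
  then show ?case using a onto by (intro exI[of _ D] exI[of _ "\<lambda>x. x"] exI[of _ a]) (auto simp: o_def)
next
  case (Suc k)
  then have k: "k < n" by simp
  obtain D1 S b J where S: "smooth_euclidean m m D1 S" "S ` D1 \<subseteq> D" "b \<in> D1" "S b = a"
    and J: "inj_on J {..<k}" "J ` {..<k} \<subseteq> {..<m}"
    and "\<forall>x\<in>D1. \<forall>i<k. f (S x) i = x (J i)"
    and ontoS: "jacobian_map m n (f \<circ> S) b ` euclid m = euclid n"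
    using Suc.IH[OF less_imp_le[OF k]] by (elim exE conjE) (rule that)
  then have straight: "\<And>x i. x \<in> D1 \<Longrightarrow> i < k \<Longrightarrow> f (S x) i = x (J i)" by blast
  define F where "F = f \<circ> S"
  have F: "smooth_euclidean m n D1 F"
    unfolding F_def by (rule smooth_euclidean_compose[OF S(1) f S(2)])
  have D1: "openin (Euclidean_space m) D1" using smooth_euclidean_openin[OF F] .
  have "(\<lambda>i. if i = k then 1 else 0) \<in> euclid n" using k by (auto simp: euclid_iff)
  then obtain v where v: "jacobian_map m n F b v = (\<lambda>i. if i = k then 1 else 0)"
    using ontoS unfolding F_def by (metis (no_types, lifting) imageE)
  \<comment> \<open>Component \<open>i\<close> of \<open>F\<close> is the coordinate
    \<open>J i\<close>, so row \<open>i\<close> of the Jacobian is a unit row and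
    \<open>v (J i)\<close> is entry \<open>i\<close> of the unit vector with index \<open>k\<close>,
    which is zero.\<close>
  have vJ: "v (J i) = 0" if i: "i < k" for i
  proof -
    have "partial_deriv j (\<lambda>x. F x i) b = (if j = J i then 1 else 0)" if j: "j < m" for j
    proof -
      have "partial_deriv j (\<lambda>x. F x i) b = partial_deriv j (\<lambda>x. x (J i)) b"
        unfolding partial_deriv_def
        by (rule deriv_cong_ev[OF partial_deriv_cong[OF D1 S(3) j] refl]) (simp add: F_def straight i)
      also have "\<dots> = (if j = J i then 1 else 0)"
        unfolding partial_deriv_def by (cases "j = J i") auto
      finally show ?thesis .
    qed
    then have "(\<Sum>j<m. partial_deriv j (\<lambda>x. F x i) b * v j) = (\<Sum>j<m. if j = J i then v j else 0)"
      by (intro sum.cong) auto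
    also have "\<dots> = v (J i)" using J(2) i by (subst sum.delta) auto
    finally show ?thesis using fun_cong[OF v, of i] i k by (simp add: jacobian_map_def)
  qed
  \<comment> \<open>A nonzero term of this sum has both a nonzero partial derivative and
    \<open>v j \<noteq> 0\<close>; the latter separates \<open>j\<close> from the indices already
    used.\<close>
  have "(\<Sum>j<m. partial_deriv j (\<lambda>x. F x k) b * v j) = 1"
    using fun_cong[OF v, of k] k by (simp add: jacobian_map_def)
  then obtain j where j: "j < m" "partial_deriv j (\<lambda>x. F x k) b * v j \<noteq> 0"
    by (metis (no_types, lifting) lessThan_iff sum.neutral zero_neq_one)
  have jJ: "J i \<noteq> j" if "i < k" for i using vJ[OF that] j(2) by auto
  define d where "d l = partial_deriv l (\<lambda>x. F x k) b" for l
  have dj: "d j \<noteq> 0" using j(2) by (auto simp: d_def)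
  \<comment> \<open>The new base point, mapped to \<open>b\<close> by \<open>\<Psi>\<close>: slot
    \<open>j\<close> now holds the value of component \<open>k\<close>.\<close>
  define b' where "b' = b(j := F b k)"
  obtain D' h where D': "openin (Euclidean_space m) D'" "b' \<in> D'" and hb: "h b' = b j"
    and h: "\<And>x. x \<in> D' \<Longrightarrow> x(j := h x) \<in> D1" "\<And>x. x \<in> D' \<Longrightarrow> F (x(j := h x)) k = x j"
    and Ch: "\<And>k. C_k k m D' h"
    and der: "\<And>x l. x \<in> D' \<Longrightarrow> l < m \<Longrightarrow> ((\<lambda>t. h (x(l := t))) has_real_derivative
        (if l = j then 1 else - partial_deriv l (\<lambda>x. F x k) (x(j := h x))) *
          inverse (partial_deriv j (\<lambda>x. F x k) (x(j := h x)))) (at (x l))"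
    using implicit_coordinate[OF D1 smooth_euclidean_C_k[OF F k] S(3) j(1)] dj
    unfolding b'_def d_def by blast
  define \<Psi> where "\<Psi> x = x(j := h x)" for x :: "nat \<Rightarrow> real"
  have \<Psi>D1: "\<Psi> ` D' \<subseteq> D1" using h(1) by (auto simp: \<Psi>_def)
  have \<Psi>: "smooth_euclidean m m D' \<Psi>"
  proof (rule smooth_euclideanI[OF D'(1)])
    show "\<Psi> ` D' \<subseteq> euclid m" using \<Psi>D1 openin_subset[OF D1] by blast
    show "C_k k m D' (\<lambda>x. \<Psi> x i)" for k i
      using Ch C_k_coordinate[OF D'(1)] by (cases "i = j") (auto simp: \<Psi>_def)
  qed
  have \<Psi>b: "\<Psi> b' = b" using hb by (simp add: \<Psi>_def b'_def)
  have "jacobian_map m m \<Psi> b' ` euclid m = euclid m"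
  proof
    show "jacobian_map m m \<Psi> b' ` euclid m \<subseteq> euclid m" using jacobian_map_in_euclid by blast
    show "euclid m \<subseteq> jacobian_map m m \<Psi> b' ` euclid m"
    proof
      fix u assume u: "u \<in> euclid m"
      \<comment> \<open>The image of \<open>u\<close> under the differential at \<open>b\<close> of
        \<open>z \<mapsto> z(j := F z k)\<close>, the map that \<open>\<Psi>\<close>
        inverts.\<close>
      define w where "w = u(j := \<Sum>l<m. d l * u l)"
      have "jacobian_map m m \<Psi> b' w i = u i" if i: "i < m" for i
      proof (cases "i = j")
        case False
        have "partial_deriv l (\<lambda>x. \<Psi> x i) b' = (if l = i then 1 else 0)" for l
          unfolding partial_deriv_def using False by (cases "l = i") (auto simp: \<Psi>_def)
        then have "(\<Sum>l<m. partial_deriv l (\<lambda>x. \<Psi> x i) b' * w l) = (\<Sum>l<m. if l = i then w l else 0)"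
          by (intro sum.cong) auto
        also have "\<dots> = w i" using i by (subst sum.delta) auto
        finally show ?thesis using False i by (simp add: w_def jacobian_map_def)
      next
        case True
        have "partial_deriv l (\<lambda>x. \<Psi> x j) b' = (if l = j then 1 else - d l) * inverse (d j)"
          if "l < m" for l
          unfolding \<Psi>_def fun_upd_same d_def partial_deriv_def[of l h]
          by (rule DERIV_imp_deriv[OF der[OF D'(2) that, folded \<Psi>_def, unfolded \<Psi>b]])
        then have "jacobian_map m m \<Psi> b' w i = (\<Sum>l<m. (if l = j then 1 else - d l) * inverse (d j) * w l)"
          using True i by (simp add: jacobian_map_def)
        also have "\<dots> = w j * inverse (d j) + (\<Sum>l\<in>{..<m} - {j}. (- d l) * inverse (d j) * w l)"
          using j(1) by (subst sum.remove[of _ j]) auto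
        also have "(\<Sum>l\<in>{..<m} - {j}. (- d l) * inverse (d j) * w l)
            = - inverse (d j) * (\<Sum>l\<in>{..<m} - {j}. d l * u l)"
          unfolding sum_distrib_left by (intro sum.cong) (auto simp: w_def)
        also have "w j = d j * u j + (\<Sum>l\<in>{..<m} - {j}. d l * u l)"
          using j(1) by (simp add: w_def sum.remove[of _ j])
        finally show ?thesis using dj True by (simp add: field_simps)
      qed
      then have "jacobian_map m m \<Psi> b' w = u"
        by (rule euclid_eqI[OF jacobian_map_in_euclid u])
      moreover have "w \<in> euclid m" using u j(1) by (simp add: w_def)
      ultimately show "u \<in> jacobian_map m m \<Psi> b' ` euclid m" by blast
    qed
  qed
  moreover have "jacobian_map m n (F \<circ> \<Psi>) b' v = jacobian_map m n F b (jacobian_map m m \<Psi> b' v)" for v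
    using jacobian_map_compose[OF \<Psi> F \<Psi>D1 D'(2)] \<Psi>b by simp
  ultimately have onto': "jacobian_map m n (f \<circ> (S \<circ> \<Psi>)) b' ` euclid m = euclid n"
    using ontoS unfolding F_def o_assoc by (metis (no_types, lifting) image_cong image_image)
  define J' where "J' = J(k := j)"
  have "inj_on J' {..<Suc k}"
    using J(1) jJ unfolding J'_def lessThan_Suc inj_on_insert by (auto simp: inj_on_def)
  moreover have "J' ` {..<Suc k} \<subseteq> {..<m}"
    using J(2) j(1) by (auto simp: J'_def less_Suc_eq image_subset_iff)
  moreover have "\<forall>x\<in>D'. \<forall>i<Suc k. f ((S \<circ> \<Psi>) x) i = x (J' i)"
  proof (intro ballI allI impI)
    fix x i assume x: "x \<in> D'" and "i < Suc k"
    then consider "i = k" | "i < k" by linarith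
    then show "f ((S \<circ> \<Psi>) x) i = x (J' i)"
    proof cases
      case 1
      then show ?thesis using h(2)[OF x] by (simp add: F_def \<Psi>_def J'_def)
    next
      case 2
      \<comment> \<open>Components straightened earlier stay straight, because \<open>\<Psi>\<close>
        alters only coordinate \<open>j\<close>.\<close>
      then have "f (S (\<Psi> x)) i = \<Psi> x (J i)" using straight \<Psi>D1 x by blast
      then show ?thesis using jJ[OF 2] 2 by (simp add: \<Psi>_def J'_def)
    qed
  qed
  moreover have "smooth_euclidean m m D' (S \<circ> \<Psi>)" by (rule smooth_euclidean_compose[OF \<Psi> S(1) \<Psi>D1])
  moreover have "(S \<circ> \<Psi>) ` D' \<subseteq> D" using \<Psi>D1 S(2) by auto
  moreover have "(S \<circ> \<Psi>) b' = a" using \<Psi>b S(4) by simp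
  ultimately show ?case using D'(2) onto' by blast
qed

text \<open>In the coordinates \<open>S\<close> the components of \<open>f\<close> are distinct
  coordinates. \<open>E\<close> writes a prescribed value into these and keeps the others as in
  \<open>b\<close>, so \<open>S \<circ> E\<close> is a section.\<close>

lemma euclidean_submersion_local_section:
  assumes f: "smooth_euclidean m n D f" and a: "a \<in> D"
    and onto: "jacobian_map m n f a ` euclid m = euclid n"
  obtains B s where "smooth_euclidean n m B s" "f a \<in> B" "s ` B \<subseteq> D" "\<And>y. y \<in> B \<Longrightarrow> f (s y) = y"
proof -
  obtain D1 S b J where S: "smooth_euclidean m m D1 S" "S ` D1 \<subseteq> D" "b \<in> D1" "S b = a"
    and J: "inj_on J {..<n}" "J ` {..<n} \<subseteq> {..<m}"
    and "\<forall>x\<in>D1. \<forall>i<n. f (S x) i = x (J i)"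
    using components_as_coordinates[OF f a onto order_refl] by (elim exE conjE) (rule that)
  then have straight: "\<And>x i. x \<in> D1 \<Longrightarrow> i < n \<Longrightarrow> f (S x) i = x (J i)" by blast
  have D1: "openin (Euclidean_space m) D1" using smooth_euclidean_openin[OF S(1)] .
  have be: "b \<in> euclid m" using openin_Euclidean_subset[OF D1 S(3)] .
  define E where "E y l = (if l \<in> J ` {..<n} then y (the_inv_into {..<n} J l) else b l)"
    for y :: "nat \<Rightarrow> real" and l
  have EJ: "E y (J i) = y i" if "i < n" for y i
    using the_inv_into_f_f[OF J(1)] that by (simp add: E_def)
  have E: "smooth_euclidean n m (euclid n) E"
  proof (rule smooth_euclideanI)
    show "E ` euclid n \<subseteq> euclid m"
    proof (clarsimp simp: euclid_iff)
      show "E y l = 0" if "m \<le> l" for y l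
        using J(2) that be by (auto simp: E_def euclid_iff)
    qed
    show "C_k k n (euclid n) (\<lambda>y. E y l)" for k l
      by (cases "l \<in> J ` {..<n}") (simp_all add: E_def C_k_const C_k_coordinate)
  qed simp
  define B where "B = {y \<in> euclid n. E y \<in> D1}"
  have B: "openin (Euclidean_space n) B"
    unfolding B_def by (rule smooth_euclidean_openin_preimage[OF E D1])
  have EB: "E ` B \<subseteq> D1" by (auto simp: B_def)
  have fae: "f a \<in> euclid n" using smooth_euclidean_image[OF f] a by blast
  \<comment> \<open>The slice passes through \<open>b\<close>: its \<open>J\<close> entries are the
    components of \<open>f a\<close>, the others were frozen at \<open>b\<close>.\<close>
  have "E (f a) = b"
  proof
    fix l
    show "E (f a) l = b l"
    proof (cases "l \<in> J ` {..<n}")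
      case True
      then obtain i where "i < n" "l = J i" by auto
      then show ?thesis using EJ straight[OF S(3)] S(4) by simp
    qed (simp add: E_def)
  qed
  then have "f a \<in> B" using fae S(3) by (simp add: B_def)
  moreover have "smooth_euclidean n m B (S \<circ> E)"
    by (rule smooth_euclidean_compose[OF smooth_euclidean_subset[OF E B] S(1) EB]) (auto simp: B_def)
  moreover have "(S \<circ> E) ` B \<subseteq> D" using EB S(2) by auto
  moreover have "f ((S \<circ> E) y) = y" if y: "y \<in> B" for y
  proof (rule euclid_eqI)
    show "f ((S \<circ> E) y) \<in> euclid n"
      using smooth_euclidean_image[OF f] \<open>(S \<circ> E) ` B \<subseteq> D\<close> y by blast
    show "y \<in> euclid n" using y by (simp add: B_def)
    show "f ((S \<circ> E) y) i = y i" if "i < n" for i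
      using straight[of "E y" i] EJ that EB y by auto
  qed
  ultimately show ?thesis using that by blast
qed

section \<open>Plots of manifolds and of leaf spaces\<close>

lemma
  assumes "manifold M" "(V, \<phi>) \<in> charts M"
  shows chart_subset: "V \<subseteq> points M"
    and chart_inj: "inj_on \<phi> V"
  using assms by (fastforce simp: manifold_def maximal_atlas_def smooth_atlas_def is_chart_def)+

lemma chart_transition:
  assumes "manifold M" "(V, \<phi>) \<in> charts M" "(W, \<eta>) \<in> charts M"
  shows "smooth_euclidean (mdim M) (mdim M) (\<phi> ` (V \<inter> W)) (\<eta> \<circ> inv_into V \<phi>)"
proof -
  have "compatible_charts (mdim M) (V, \<phi>) (W, \<eta>)"
    using assms unfolding manifold_def maximal_atlas_def smooth_atlas_def by blast
  then show ?thesis by (simp add: compatible_charts_def smooth_transition_def)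
qed

lemma chart_at:
  assumes "manifold M" "x \<in> points M"
  obtains V \<phi> where "(V, \<phi>) \<in> charts M" "x \<in> V"
proof -
  have "(\<Union>(V, \<phi>)\<in>charts M. V) = points M"
    using assms(1) by (simp add: manifold_def maximal_atlas_def smooth_atlas_def)
  with assms(2) show ?thesis using that by blast
qed

lemma smooth_from_openin: "smooth_from m D M q \<Longrightarrow> openin (Euclidean_space m) D"
  and smooth_from_in_points: "smooth_from m D M q \<Longrightarrow> s \<in> D \<Longrightarrow> q s \<in> points M"
  by (auto simp: smooth_from_def)

lemma smooth_from_chart_at:
  assumes "smooth_from m D M q" "r \<in> D"
  obtains D' W \<eta> where "r \<in> D'" "D' \<subseteq> D" "(W, \<eta>) \<in> charts M" "q ` D' \<subseteq> W"
    "smooth_euclidean m (mdim M) D' (\<eta> \<circ> q)"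
  using assms unfolding smooth_from_def by blast

text \<open>\<open>smooth_from\<close> promises only some chart near \<open>q r\<close>; a
  transition map carries smoothness over to the given one.\<close>

lemma smooth_from_in_chart:
  assumes M: "manifold M" and q: "smooth_from m D M q" and W: "(W, \<eta>) \<in> charts M"
    and r: "r \<in> D" "q r \<in> W"
  obtains D' where "r \<in> D'" "D' \<subseteq> D" "q ` D' \<subseteq> W" "smooth_euclidean m (mdim M) D' (\<eta> \<circ> q)"
proof -
  obtain D1 V \<phi> where D1: "r \<in> D1" "D1 \<subseteq> D" "(V, \<phi>) \<in> charts M" "q ` D1 \<subseteq> V"
    "smooth_euclidean m (mdim M) D1 (\<phi> \<circ> q)"
    using smooth_from_chart_at[OF q r(1)] .
  note trans = chart_transition[OF M D1(3) W]
  \<comment> \<open>Open because smoothness of the transition includes openness of its domain;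
    injectivity of \<open>\<phi>\<close> then puts \<open>q s\<close> itself into the
    overlap.\<close>
  define D' where "D' = {s \<in> D1. (\<phi> \<circ> q) s \<in> \<phi> ` (V \<inter> W)}"
  have D': "openin (Euclidean_space m) D'"
    unfolding D'_def
    by (rule smooth_euclidean_openin_preimage[OF D1(5) smooth_euclidean_openin[OF trans]])
  have qW: "q s \<in> W" if "s \<in> D'" for s
    using that D1(4) inj_onD[OF chart_inj[OF M D1(3)]] by (fastforce simp: D'_def)
  have inv: "inv_into V \<phi> (\<phi> (q s)) = q s" if "s \<in> D'" for s
    using that D1(4) inv_into_f_f[OF chart_inj[OF M D1(3)]] by (auto simp: D'_def)
  have "smooth_euclidean m (mdim M) D' ((\<eta> \<circ> inv_into V \<phi>) \<circ> (\<phi> \<circ> q))"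
    by (rule smooth_euclidean_compose[OF smooth_euclidean_subset[OF D1(5) D'] trans])
      (auto simp: D'_def)
  then have "smooth_euclidean m (mdim M) D' (\<eta> \<circ> q)"
    by (rule smooth_euclidean_cong) (simp add: inv)
  moreover have "r \<in> D'" using D1(1,4) r(2) by (auto simp: D'_def)
  moreover have "D' \<subseteq> D" using D1(2) by (auto simp: D'_def)
  ultimately show ?thesis using that[of D'] qW by blast
qed

text \<open>Inserting a chart of \<open>M\<close> and its inverse between \<open>f\<close> and
  \<open>q\<close> splits the coordinate expression into two smooth Cartesian maps.\<close>

lemma smooth_map_compose_smooth_from:
  assumes M: "manifold M" and f: "smooth_map M N f" and q: "smooth_from m D M q"
  shows "smooth_from m D N (f \<circ> q)"
  unfolding smooth_from_def
proof (intro conjI ballI)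
  show "openin (Euclidean_space m) D" using smooth_from_openin[OF q] .
  show "f \<circ> q \<in> D \<rightarrow> points N"
    using smooth_from_in_points[OF q] f by (auto simp: smooth_map_def)
  fix r assume r: "r \<in> D"
  obtain D1 V \<phi> where D1: "r \<in> D1" "D1 \<subseteq> D" "(V, \<phi>) \<in> charts M" "q ` D1 \<subseteq> V"
    "smooth_euclidean m (mdim M) D1 (\<phi> \<circ> q)"
    using smooth_from_chart_at[OF q r] .
  have f': "smooth_from (mdim M) (\<phi> ` V) N (f \<circ> inv_into V \<phi>)"
    using f D1(3) unfolding smooth_map_def by blast
  have "\<phi> (q r) \<in> \<phi> ` V" using D1(1,4) by blast
  from smooth_from_chart_at[OF f' this] obtain D2 W \<eta> where D2: "\<phi> (q r) \<in> D2" "D2 \<subseteq> \<phi> ` V"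
    "(W, \<eta>) \<in> charts N" "(f \<circ> inv_into V \<phi>) ` D2 \<subseteq> W"
    "smooth_euclidean (mdim M) (mdim N) D2 (\<eta> \<circ> (f \<circ> inv_into V \<phi>))" .
  define D' where "D' = {s \<in> D1. (\<phi> \<circ> q) s \<in> D2}"
  have D': "openin (Euclidean_space m) D'"
    unfolding D'_def
    by (rule smooth_euclidean_openin_preimage[OF D1(5) smooth_euclidean_openin[OF D2(5)]])
  have inv: "inv_into V \<phi> (\<phi> (q s)) = q s" if "s \<in> D'" for s
    using that D1(4) inv_into_f_f[OF chart_inj[OF M D1(3)]] by (auto simp: D'_def)
  have "smooth_euclidean m (mdim N) D' ((\<eta> \<circ> (f \<circ> inv_into V \<phi>)) \<circ> (\<phi> \<circ> q))"
    by (rule smooth_euclidean_compose[OF smooth_euclidean_subset[OF D1(5) D'] D2(5)])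
      (auto simp: D'_def)
  then have "smooth_euclidean m (mdim N) D' (\<eta> \<circ> (f \<circ> q))"
    by (rule smooth_euclidean_cong) (simp add: inv)
  moreover have "(f \<circ> q) ` D' \<subseteq> W"
  proof clarify
    fix s assume s: "s \<in> D'"
    then have "(f \<circ> inv_into V \<phi>) (\<phi> (q s)) \<in> W" using D2(4) by (auto simp: D'_def)
    then show "(f \<circ> q) s \<in> W" using inv[OF s] by simp
  qed
  moreover have "r \<in> D'" "D' \<subseteq> D" using D1(1,2) D2(1) by (auto simp: D'_def)
  ultimately show "\<exists>D' W \<eta>. r \<in> D' \<and> D' \<subseteq> D \<and> (W, \<eta>) \<in> charts N \<and> (f \<circ> q) ` D' \<subseteq> W \<and>
      smooth_euclidean m (mdim N) D' (\<eta> \<circ> (f \<circ> q))"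
    using D2(3) by blast
qed

text \<open>Surjectivity gives a point \<open>x\<close> over \<open>q r\<close>. Near
  \<open>x\<close> the coordinate expression of \<open>p\<close> has a smooth section, and the lift
  is that section applied to \<open>q\<close> in coordinates.\<close>

lemma submersion_local_lift:
  assumes M: "manifold M" and N: "manifold N" and p: "submersion M N p" "p ` points M = points N"
    and q: "smooth_from m D N q" and r: "r \<in> D"
  obtains D' q' where "r \<in> D'" "D' \<subseteq> D" "smooth_from m D' M q'" "\<And>s. s \<in> D' \<Longrightarrow> p (q' s) = q s"
proof -
  obtain x where x: "x \<in> points M" "p x = q r"
    using p(2) smooth_from_in_points[OF q r] by (metis imageE)
  obtain V \<phi> where V: "(V, \<phi>) \<in> charts M" "x \<in> V" using chart_at[OF M x(1)] .
  note inj\<phi> = chart_inj[OF M V(1)]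
  have p': "smooth_from (mdim M) (\<phi> ` V) N (p \<circ> inv_into V \<phi>)"
    using p(1) V(1) unfolding submersion_def smooth_map_def by blast
  from smooth_from_chart_at[OF p' imageI[OF V(2)]] obtain D1 W \<eta> where D1: "\<phi> x \<in> D1" "D1 \<subseteq> \<phi> ` V"
    "(W, \<eta>) \<in> charts N" "(p \<circ> inv_into V \<phi>) ` D1 \<subseteq> W"
    "smooth_euclidean (mdim M) (mdim N) D1 (\<eta> \<circ> (p \<circ> inv_into V \<phi>))" .
  have px: "p x \<in> W" using D1(1,4) inv_into_f_f[OF inj\<phi> V(2)] by force
  have "differential_in M N p x (V, \<phi>) (W, \<eta>) ` euclid (mdim M) = euclid (mdim N)"
    using p(1) x(1) V D1(3) px unfolding submersion_def by (metis fst_conv)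
  then have onto: "jacobian_map (mdim M) (mdim N) (\<eta> \<circ> (p \<circ> inv_into V \<phi>)) (\<phi> x) ` euclid (mdim M)
      = euclid (mdim N)"
    by (simp add: differential_in_def o_assoc)
  obtain B \<sigma> where \<sigma>: "smooth_euclidean (mdim N) (mdim M) B \<sigma>"
    "(\<eta> \<circ> (p \<circ> inv_into V \<phi>)) (\<phi> x) \<in> B" "\<sigma> ` B \<subseteq> D1"
    "\<And>y. y \<in> B \<Longrightarrow> (\<eta> \<circ> (p \<circ> inv_into V \<phi>)) (\<sigma> y) = y"
    using euclidean_submersion_local_section[OF D1(5,1) onto] by blast
  have qr: "\<eta> (q r) \<in> B" using \<sigma>(2) x(2) inv_into_f_f[OF inj\<phi> V(2)] by simp
  \<comment> \<open>The chart of \<open>N\<close> is dictated by the coordinate expression of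
    \<open>p\<close>, so \<open>q\<close> has to be read in this chart.\<close>
  obtain D2 where D2: "r \<in> D2" "D2 \<subseteq> D" "q ` D2 \<subseteq> W" "smooth_euclidean m (mdim N) D2 (\<eta> \<circ> q)"
    using smooth_from_in_chart[OF N q D1(3) r] px x(2) by metis
  define D' where "D' = {s \<in> D2. (\<eta> \<circ> q) s \<in> B}"
  have D': "openin (Euclidean_space m) D'"
    unfolding D'_def
    by (rule smooth_euclidean_openin_preimage[OF D2(4) smooth_euclidean_openin[OF \<sigma>(1)]])
  define q' where "q' = inv_into V \<phi> \<circ> (\<sigma> \<circ> (\<eta> \<circ> q))"
  have \<sigma>D1: "\<sigma> (\<eta> (q s)) \<in> D1" if "s \<in> D'" for s using that \<sigma>(3) by (auto simp: D'_def)
  have \<phi>q': "\<phi> (q' s) = \<sigma> (\<eta> (q s))" and q'V: "q' s \<in> V" if "s \<in> D'" for s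
    using \<sigma>D1[OF that] D1(2) by (auto simp: q'_def f_inv_into_f inv_into_into)
  have "smooth_euclidean m (mdim M) D' (\<sigma> \<circ> (\<eta> \<circ> q))"
    by (rule smooth_euclidean_compose[OF smooth_euclidean_subset[OF D2(4) D'] \<sigma>(1)])
      (auto simp: D'_def)
  then have "smooth_euclidean m (mdim M) D' (\<phi> \<circ> q')"
    by (rule smooth_euclidean_cong) (simp add: \<phi>q')
  then have "smooth_from m D' M q'"
    unfolding smooth_from_def using D' q'V V(1) chart_subset[OF M V(1)] by blast
  moreover have "p (q' s) = q s" if s: "s \<in> D'" for s
  \<comment> \<open>The section property compares only coordinates; injectivity of
    \<open>\<eta>\<close> on \<open>W\<close> turns it into equality of points.\<close>
  proof (rule inj_onD[OF chart_inj[OF N D1(3)]])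
    show "\<eta> (p (q' s)) = \<eta> (q s)"
      using \<sigma>(4)[of "\<eta> (q s)"] s by (simp add: q'_def D'_def)
    show "p (q' s) \<in> W" using \<sigma>D1[OF s] D1(4) by (auto simp: q'_def)
    show "q s \<in> W" using D2(3) s by (auto simp: D'_def)
  qed
  moreover have "r \<in> D'" "D' \<subseteq> D" using D2(1,2) qr by (auto simp: D'_def)
  ultimately show ?thesis using that by blast
qed

section \<open>Leaves, pulled-back partitions and plots of leaf spaces\<close>

lemma leaf_through_eqI:
  assumes "partition_on A \<F>" "L \<in> \<F>" "x \<in> L"
  shows "leaf_through \<F> x = L"
  unfolding leaf_through_def
  using assms by (intro the_equality) (auto simp: partition_on_def disjoint_def)

lemma leaf_through_props:
  assumes "partition_on A \<F>" "x \<in> A"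
  shows "leaf_through \<F> x \<in> \<F>" "x \<in> leaf_through \<F> x"
proof -
  obtain L where "L \<in> \<F>" "x \<in> L" using assms by (auto simp: partition_on_def)
  then show "leaf_through \<F> x \<in> \<F>" "x \<in> leaf_through \<F> x"
    using leaf_through_eqI[OF assms(1)] by auto
qed

text \<open>By surjectivity, taking images under \<open>p\<close> is a left inverse of pulling
  leaves back; this also recovers a leaf from its preimage in the Molino case.\<close>

lemma image_leaf_preimage:
  assumes "p ` points M = points N" "partition_on (points N) \<F>" "L \<in> \<F>"
  shows "p ` leaf_preimage M p L = L"
  using assms by (fastforce simp: leaf_preimage_def partition_on_def)

lemma inj_on_leaf_preimage:
  assumes "p ` points M = points N" "partition_on (points N) \<F>"
  shows "inj_on (leaf_preimage M p) \<F>"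
  using image_leaf_preimage[OF assms] by (rule inj_on_inverseI)

text \<open>Makes \<open>leaf_through\<close> well determined on \<open>M\<close>; surjectivity of
  \<open>p\<close> keeps the pulled-back leaves nonempty.\<close>

lemma partition_on_pullback:
  assumes p: "p ` points M = points N" and F: "partition_on (points N) \<F>"
  shows "partition_on (points M) (pullback_foliation M p \<F>)"
proof (rule partition_onI)
  show "\<Union> (pullback_foliation M p \<F>) = points M"
    using assms by (fastforce simp: pullback_foliation_def leaf_preimage_def partition_on_def)
  show "disjnt P P'" if PP': "P \<in> pullback_foliation M p \<F>" "P' \<in> pullback_foliation M p \<F>" "P \<noteq> P'" for P P'
  proof -
    obtain L L' where "P = leaf_preimage M p L" "P' = leaf_preimage M p L'" "L \<in> \<F>" "L' \<in> \<F>" "L \<noteq> L'"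
      using PP' by (auto simp: pullback_foliation_def)
    with F show ?thesis by (auto simp: leaf_preimage_def disjnt_def partition_on_def disjoint_def)
  qed
  show "{} \<notin> pullback_foliation M p \<F>"
  proof
    assume "{} \<in> pullback_foliation M p \<F>"
    then obtain L where L: "leaf_preimage M p L = {}" "L \<in> \<F>"
      by (auto simp: pullback_foliation_def)
    then have "L = {}" using image_leaf_preimage[OF p F L(2)] by simp
    with F L(2) show False by (auto simp: partition_on_def)
  qed
qed

lemma leaf_space_plot_openin:
    "leaf_space_diffeology M \<F> m D q \<Longrightarrow> openin (Euclidean_space m) D"
  and leaf_space_plot_in: "leaf_space_diffeology M \<F> m D q \<Longrightarrow> s \<in> D \<Longrightarrow> q s \<in> \<F>"
  unfolding leaf_space_diffeology_def by (elim conjE, assumption) (elim conjE, erule funcset_mem)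

lemma leaf_space_plot_at:
  assumes "leaf_space_diffeology M \<F> m D q" "r \<in> D"
  obtains D' q' where "r \<in> D'" "D' \<subseteq> D" "smooth_from m D' M q'"
    "\<And>s. s \<in> D' \<Longrightarrow> q s = leaf_through \<F> (q' s)"
proof -
  have "\<exists>D' q'. r \<in> D' \<and> D' \<subseteq> D \<and> openin (Euclidean_space m) D' \<and> smooth_from m D' M q' \<and>
      (\<forall>s\<in>D'. q s = leaf_through \<F> (q' s))"
    using assms unfolding leaf_space_diffeology_def by (elim conjE) (erule bspec)
  then show ?thesis
    by (elim exE conjE) (rule that, assumption+, erule bspec)
qed

text \<open>The openness of \<open>D'\<close> required by the definition is already part of
  \<open>smooth_from\<close>.\<close>

lemma leaf_space_plotI:
  assumes "openin (Euclidean_space m) D" "\<And>s. s \<in> D \<Longrightarrow> q s \<in> \<F>"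
    and local: "\<And>r. r \<in> D \<Longrightarrow> \<exists>D' q'. r \<in> D' \<and> D' \<subseteq> D \<and> smooth_from m D' M q' \<and>
      (\<forall>s\<in>D'. q s = leaf_through \<F> (q' s))"
  shows "leaf_space_diffeology M \<F> m D q"
  unfolding leaf_space_diffeology_def
proof (intro conjI ballI)
  fix r assume "r \<in> D"
  from local[OF this] show "\<exists>D' q'. r \<in> D' \<and> D' \<subseteq> D \<and> openin (Euclidean_space m) D' \<and>
      smooth_from m D' M q' \<and> (\<forall>s\<in>D'. q s = leaf_through \<F> (q' s))"
    by (elim exE conjE) (intro exI conjI, assumption+, rule smooth_from_openin)
qed (use assms(1,2) in auto)

text \<open>Plots are total functions in the formalization; this allows replacing one by another
  that agrees with it only on its domain.\<close>

lemma leaf_space_diffeology_cong: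
  assumes q: "leaf_space_diffeology M \<F> m D q" and eq: "\<And>s. s \<in> D \<Longrightarrow> q s = q' s"
  shows "leaf_space_diffeology M \<F> m D q'"
proof (rule leaf_space_plotI)
  show "openin (Euclidean_space m) D" using leaf_space_plot_openin[OF q] .
  show "q' s \<in> \<F>" if "s \<in> D" for s
    using leaf_space_plot_in[OF q that] eq[OF that] by simp
  fix r assume "r \<in> D"
  from leaf_space_plot_at[OF q this] obtain D' q1 where
    D': "r \<in> D'" "D' \<subseteq> D" "smooth_from m D' M q1" "\<And>s. s \<in> D' \<Longrightarrow> q s = leaf_through \<F> (q1 s)"
    by blast
  have "q' s = leaf_through \<F> (q1 s)" if "s \<in> D'" for s
    using D'(2,4) eq that by (metis subsetD)
  with D'(1-3) show "\<exists>D' q1. r \<in> D' \<and> D' \<subseteq> D \<and> smooth_from m D' M q1 \<and>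
      (\<forall>s\<in>D'. q' s = leaf_through \<F> (q1 s))"
    by blast
qed

section \<open>The diffeomorphisms of leaf spaces\<close>

lemma pullback_leaf_space_diffeomorphism:
  assumes M: "manifold M" and N: "manifold N" and p: "submersion M N p" "p ` points M = points N"
    and F: "partition_on (points N) \<F>"
  shows "leaf_space_diffeomorphism N \<F> M (pullback_foliation M p \<F>) (leaf_preimage M p)"
  unfolding leaf_space_diffeomorphism_def diffeological_diffeomorphism_def
proof (intro conjI allI impI)
  let ?P = "leaf_preimage M p" and ?G = "pullback_foliation M p \<F>"
  note inj = inj_on_leaf_preimage[OF p(2) F] and G = partition_on_pullback[OF p(2) F]
  \<comment> \<open>The quotient maps form a commutative square with \<open>p\<close> and
    \<open>?P\<close>; both directions reduce to this identity applied to lifts.\<close>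
  have leaf: "leaf_through ?G x = ?P (leaf_through \<F> (p x))" if "x \<in> points M" for x
    using that p(2) leaf_through_props[OF F, of "p x"]
    by (intro leaf_through_eqI[OF G]) (auto simp: pullback_foliation_def leaf_preimage_def)
  show "bij_betw ?P \<F> ?G"
    using inj by (simp add: bij_betw_def pullback_foliation_def)
  fix m D and q :: "(nat \<Rightarrow> real) \<Rightarrow> _"
  {
    assume q: "leaf_space_diffeology N \<F> m D q"
    show "leaf_space_diffeology M ?G m D (?P \<circ> q)"
    proof (rule leaf_space_plotI)
      show "openin (Euclidean_space m) D" using leaf_space_plot_openin[OF q] .
      show "(?P \<circ> q) s \<in> ?G" if "s \<in> D" for s
        using leaf_space_plot_in[OF q that] by (simp add: pullback_foliation_def)
      fix r assume "r \<in> D"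
      from leaf_space_plot_at[OF q this] obtain D1 q1 where q1: "r \<in> D1" "D1 \<subseteq> D"
        "smooth_from m D1 N q1" "\<And>s. s \<in> D1 \<Longrightarrow> q s = leaf_through \<F> (q1 s)" by blast
      \<comment> \<open>The lift \<open>q1\<close> into \<open>N\<close> is itself a plot, so it
        lifts further through \<open>p\<close> after shrinking its domain.\<close>
      obtain D2 q2 where q2: "r \<in> D2" "D2 \<subseteq> D1" "smooth_from m D2 M q2"
        "\<And>s. s \<in> D2 \<Longrightarrow> p (q2 s) = q1 s"
        using submersion_local_lift[OF M N p q1(3,1)] by blast
      have "(?P \<circ> q) s = leaf_through ?G (q2 s)" if "s \<in> D2" for s
        using leaf[OF smooth_from_in_points[OF q2(3) that]] q1(4) q2(2,4) that by auto
      then show "\<exists>D' q'. r \<in> D' \<and> D' \<subseteq> D \<and> smooth_from m D' M q' \<and>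
          (\<forall>s\<in>D'. (?P \<circ> q) s = leaf_through ?G (q' s))"
        using q1(2) q2(1-3) by blast
    qed
  }
  {
    assume q: "leaf_space_diffeology M ?G m D q"
    show "leaf_space_diffeology N \<F> m D (inv_into \<F> ?P \<circ> q)"
    proof (rule leaf_space_plotI)
      show "openin (Euclidean_space m) D" using leaf_space_plot_openin[OF q] .
      show "(inv_into \<F> ?P \<circ> q) s \<in> \<F>" if "s \<in> D" for s
      proof -
        have "q s \<in> ?P ` \<F>"
          using leaf_space_plot_in[OF q that] by (simp add: pullback_foliation_def)
        then show ?thesis by (simp add: inv_into_into)
      qed
      fix r assume "r \<in> D"
      from leaf_space_plot_at[OF q this] obtain D1 q1 where q1: "r \<in> D1" "D1 \<subseteq> D"
        "smooth_from m D1 M q1" "\<And>s. s \<in> D1 \<Longrightarrow> q s = leaf_through ?G (q1 s)" by blast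
      have "smooth_from m D1 N (p \<circ> q1)"
        using smooth_map_compose_smooth_from[OF M _ q1(3)] p(1) by (auto simp: submersion_def)
      moreover have "(inv_into \<F> ?P \<circ> q) s = leaf_through \<F> ((p \<circ> q1) s)" if s: "s \<in> D1" for s
      proof -
        have x: "q1 s \<in> points M" using smooth_from_in_points[OF q1(3) s] .
        then have "leaf_through \<F> (p (q1 s)) \<in> \<F>" using p(2) leaf_through_props(1)[OF F] by blast
        then show ?thesis using q1(4)[OF s] leaf[OF x] inv_into_f_f[OF inj] by simp
      qed
      ultimately show "\<exists>D' q'. r \<in> D' \<and> D' \<subseteq> D \<and> smooth_from m D' N q' \<and>
          (\<forall>s\<in>D'. (inv_into \<F> ?P \<circ> q) s = leaf_through \<F> (q' s))"
        using q1(1,2) by blast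
    qed
  }
qed

lemma molino_leaf_space_diffeomorphism:
  assumes F0: "singular_foliation N\<^sub>0 \<F>\<^sub>0" and F1: "singular_foliation N\<^sub>1 \<F>\<^sub>1"
    and wit: "molino_witnesses M \<F> N\<^sub>0 \<F>\<^sub>0 p\<^sub>0 N\<^sub>1 \<F>\<^sub>1 p\<^sub>1"
  shows "leaf_space_diffeomorphism N\<^sub>0 \<F>\<^sub>0 N\<^sub>1 \<F>\<^sub>1 (\<lambda>L. p\<^sub>1 ` leaf_preimage M p\<^sub>0 L)"
proof -
  let ?P0 = "leaf_preimage M p\<^sub>0" and ?P1 = "leaf_preimage M p\<^sub>1"
  define h where "h L = p\<^sub>1 ` ?P0 L" for L
  have N: "manifold N\<^sub>0" "partition_on (points N\<^sub>0) \<F>\<^sub>0" "manifold N\<^sub>1" "partition_on (points N\<^sub>1) \<F>\<^sub>1"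
    using F0 F1 by (auto simp: singular_foliation_def)
  have M: "manifold M" and p0: "submersion M N\<^sub>0 p\<^sub>0" "p\<^sub>0 ` points M = points N\<^sub>0"
    and p1: "submersion M N\<^sub>1 p\<^sub>1" "p\<^sub>1 ` points M = points N\<^sub>1"
    and eq: "pullback_foliation M p\<^sub>0 \<F>\<^sub>0 = \<F>" "pullback_foliation M p\<^sub>1 \<F>\<^sub>1 = \<F>"
    using wit by (auto simp: molino_witnesses_def singular_foliation_def surj_submersion_connected_fibers_def)
  have d0: "bij_betw ?P0 \<F>\<^sub>0 \<F>"
    "\<And>m D q. leaf_space_diffeology N\<^sub>0 \<F>\<^sub>0 m D q \<Longrightarrow> leaf_space_diffeology M \<F> m D (?P0 \<circ> q)"
    "\<And>m D q. leaf_space_diffeology M \<F> m D q \<Longrightarrow> leaf_space_diffeology N\<^sub>0 \<F>\<^sub>0 m D (inv_into \<F>\<^sub>0 ?P0 \<circ> q)"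
    using pullback_leaf_space_diffeomorphism[OF M N(1) p0 N(2)] eq(1)
    by (simp_all add: leaf_space_diffeomorphism_def diffeological_diffeomorphism_def)
  have d1: "bij_betw ?P1 \<F>\<^sub>1 \<F>"
    "\<And>m D q. leaf_space_diffeology N\<^sub>1 \<F>\<^sub>1 m D q \<Longrightarrow> leaf_space_diffeology M \<F> m D (?P1 \<circ> q)"
    "\<And>m D q. leaf_space_diffeology M \<F> m D q \<Longrightarrow> leaf_space_diffeology N\<^sub>1 \<F>\<^sub>1 m D (inv_into \<F>\<^sub>1 ?P1 \<circ> q)"
    using pullback_leaf_space_diffeomorphism[OF M N(3) p1 N(4)] eq(2)
    by (simp_all add: leaf_space_diffeomorphism_def diffeological_diffeomorphism_def)
  \<comment> \<open>\<open>h L\<close> is the leaf of \<open>N\<^sub>1\<close> with the same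
    preimage in \<open>M\<close> as \<open>L\<close>, since both pullbacks are the one foliation of
    \<open>M\<close>.\<close>
  have h_in: "h L \<in> \<F>\<^sub>1" and h_P: "?P1 (h L) = ?P0 L" if L: "L \<in> \<F>\<^sub>0" for L
  proof -
    have "?P0 L \<in> \<F>" using d0(1) L by (auto simp: bij_betw_def)
    then obtain L' where "L' \<in> \<F>\<^sub>1" "?P0 L = ?P1 L'" using d1(1) by (auto simp: bij_betw_def)
    then show "h L \<in> \<F>\<^sub>1" "?P1 (h L) = ?P0 L"
      using image_leaf_preimage[OF p1(2) N(4)] by (simp_all add: h_def)
  qed
  have h_eq: "(inv_into \<F>\<^sub>1 ?P1 \<circ> ?P0) L = h L" if "L \<in> \<F>\<^sub>0" for L
    using bij_betw_inv_into_left[OF d1(1) h_in[OF that]] h_P[OF that] by simp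
  have bij: "bij_betw h \<F>\<^sub>0 \<F>\<^sub>1"
    using bij_betw_trans[OF d0(1) bij_betw_inv_into[OF d1(1)]] h_eq by (simp cong: bij_betw_cong)
  \<comment> \<open>The inverse of \<open>h\<close> is the same construction with the two
    projections exchanged; the agreement holds on leaves only, hence the later passage through
    \<open>leaf_space_diffeology_cong\<close>.\<close>
  have inv_h_eq: "(inv_into \<F>\<^sub>0 ?P0 \<circ> ?P1) L = inv_into \<F>\<^sub>0 h L" if L: "L \<in> \<F>\<^sub>1" for L
  proof -
    obtain K where K: "K \<in> \<F>\<^sub>0" "L = h K" using bij L by (auto simp: bij_betw_def)
    then show ?thesis
      using h_P[OF K(1)] bij_betw_inv_into_left[OF d0(1) K(1)] bij_betw_inv_into_left[OF bij K(1)]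
      by simp
  qed
  have "leaf_space_diffeology N\<^sub>1 \<F>\<^sub>1 m D (h \<circ> q)" if q: "leaf_space_diffeology N\<^sub>0 \<F>\<^sub>0 m D q" for m D q
  proof (rule leaf_space_diffeology_cong[OF d1(3)[OF d0(2)[OF q]]])
    show "(inv_into \<F>\<^sub>1 ?P1 \<circ> (?P0 \<circ> q)) s = (h \<circ> q) s" if "s \<in> D" for s
      using h_eq[OF leaf_space_plot_in[OF q that]] by simp
  qed
  moreover have "leaf_space_diffeology N\<^sub>0 \<F>\<^sub>0 m D (inv_into \<F>\<^sub>0 h \<circ> q)"
    if q: "leaf_space_diffeology N\<^sub>1 \<F>\<^sub>1 m D q" for m D q
  proof (rule leaf_space_diffeology_cong[OF d0(3)[OF d1(2)[OF q]]])
    show "(inv_into \<F>\<^sub>0 ?P0 \<circ> (?P1 \<circ> q)) s = (inv_into \<F>\<^sub>0 h \<circ> q) s" if "s \<in> D" for s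
      using inv_h_eq[OF leaf_space_plot_in[OF q that]] by simp
  qed
  ultimately show ?thesis
    using bij unfolding leaf_space_diffeomorphism_def diffeological_diffeomorphism_def h_def[abs_def]
    by blast
qed

theorem proposition3p10:
  shows
    "(\<forall>(M :: 'a smooth_structure) (N :: 'b smooth_structure) p \<F>.
        manifold M \<and> manifold N \<and>
        surj_submersion_connected_fibers M N p \<and>
        singular_foliation N \<F> \<longrightarrow>
        leaf_space_diffeomorphism N \<F> M (pullback_foliation M p \<F>) (\<lambda>L. leaf_preimage M p L)) \<and>
     (\<forall>(M :: 'c smooth_structure) \<F>
        (N\<^sub>0 :: 'd smooth_structure) \<F>\<^sub>0 p\<^sub>0 (N\<^sub>1 :: 'e smooth_structure) \<F>\<^sub>1 p\<^sub>1.
        singular_foliation N\<^sub>0 \<F>\<^sub>0 \<and> singular_foliation N\<^sub>1 \<F>\<^sub>1 \<and>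
        molino_witnesses M \<F> N\<^sub>0 \<F>\<^sub>0 p\<^sub>0 N\<^sub>1 \<F>\<^sub>1 p\<^sub>1 \<longrightarrow>
        leaf_space_diffeomorphism N\<^sub>0 \<F>\<^sub>0 N\<^sub>1 \<F>\<^sub>1 (\<lambda>L. p\<^sub>1 ` leaf_preimage M p\<^sub>0 L))"
  by (intro conjI allI impI)
    (auto simp: surj_submersion_connected_fibers_def singular_foliation_def
      intro: pullback_leaf_space_diffeomorphism molino_leaf_space_diffeomorphism)

end
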